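(* Let $X(t)$ be the coordinate Gibbs sampler for the diagonal distribution with parameter $A$. For every $0<\alpha<1$ there exists $\beta>0$ such that for all large enough $A$, $$t_{\rm mix}(X,\alpha)\le \beta A^2 .$$
   Context: For $A>0$ let $\varphi(x)=\exp(-A^2x^2)$ and let $\pi$ be the probability distribution on $[0,1]^2$ with density proportional to $\varphi(u-v)$ at $(u,v)\in[0,1]^2$. For fixed $v\in[0,1]$, $\pi(\cdot,v)$ denotes the conditional distribution of the $u$ coordinate given $v$, i.e. the distribution on $[0,1]$ with density in $u$ proportional to $\varphi(u-v)$; similarly $\pi(u,\cdot)$ is the conditional distribution of the $v$ coordinate given $u$. The coordinate Gibbs sampler for the diagonal distribution is the Markov chain $X(t)=(X_u(t),X_v(t))$, $t=0,1,2,\dots$, on $[0,1]^2$ defined as follows. Let $r(1),r(2),\dots$ be i.i.d. with values in $\{U,V\}$, each taken with probability $1/2$. Given $X(0)\in[0,1]^2$, for $t\ge1$: if $r(t)=U$, then $X(t)=(u^+,X_v(t-1))$ with $u^+\sim\pi(\cdot,X_v(t-1))$; if $r(t)=V$, then $X(t)=(X_u(t-1),v^+)$ with $v^+\sim\pi(X_u(t-1),\cdot)$. The variables $u^+,v^+$ are conditionally independent of the past at every step. The distribution $\pi$ is stationary for this chain. Total variation distance: $\|\rho-\sigma\|_{\rm TV}=\sup_{S}|\rho(S)-\sigma(S)|$, the supremum being over measurable sets. With $\mathcal{L}(X(t))$ the law of $X(t)$, the mixing time is $$t_{\rm mix}(X,\varepsilon)=\sup_{X(0)\in[0,1]^2}\min\{t:\|\mathcal{L}(X(t))-\pi\|_{\rm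 TV}\le\varepsilon\},$$ the supremum being over deterministic starting points. *)

theory Defs
  imports "HOL-Probability.Probability"
begin

definition prop_density :: "'a measure \<Rightarrow> ('a \<Rightarrow> real) \<Rightarrow> 'a measure" where
  "prop_density M f = density M (\<lambda>x. ennreal (f x) / (\<integral>\<^sup>+y. ennreal (f y) \<partial>M))"

text \<open>The supremum is meant for probability measures with \<open>sets M = sets N\<close>.\<close>

definition tv_dist :: "'a measure \<Rightarrow> 'a measure \<Rightarrow> real" where
  "tv_dist M N = (SUP S\<in>sets M. \<bar>measure M S - measure N S\<bar>)"

text \<open>\<open>chain_law M K x t\<close> is the law at time \<open>t\<close> of the Markov chain on the measurable space
  \<open>M\<close> with transition kernel \<open>K\<close>, started at the deterministic point \<open>x\<close>.\<close>

primrec chain_law :: "'a measure \<Rightarrow> ('a \<Rightarrow> 'a measure) \<Rightarrow> 'a \<Rightarrow> nat \<Rightarrow> 'a measure" where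
  "chain_law M K x 0 = return M x"
| "chain_law M K x (Suc t) = chain_law M K x t \<bind> K"

text \<open>With values in \<^typ>\<open>enat\<close>, the minimum over an empty set of times and an unbounded
  supremum are both \<open>\<infinity>\<close>.\<close>

definition mixing_time ::
    "'a measure \<Rightarrow> 'a set \<Rightarrow> ('a \<Rightarrow> 'a measure) \<Rightarrow> 'a measure \<Rightarrow> real \<Rightarrow> enat" where
  "mixing_time M S K \<pi> \<epsilon> =
     (SUP x\<in>S. INF t\<in>{t. tv_dist (chain_law M K x t) \<pi> \<le> \<epsilon>}. enat t)"

definition gauss_weight :: "real \<Rightarrow> real \<Rightarrow> real" where
  "gauss_weight A x = exp (- (A\<^sup>2 * x\<^sup>2))"

abbreviation unit_square :: "(real \<times> real) set" where
  "unit_square \<equiv> {0..1} \<times> {0..1}"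

text \<open>All distributions below are Borel measures on the whole line or plane that are
  concentrated on the unit interval or the unit square.\<close>

definition diag_dist :: "real \<Rightarrow> (real \<times> real) measure" where
  "diag_dist A = prop_density lborel
     (\<lambda>(u, v). indicator unit_square (u, v) * gauss_weight A (u - v))"

definition cond_u :: "real \<Rightarrow> real \<Rightarrow> real measure" where
  "cond_u A v = prop_density lborel (\<lambda>u. indicator {0..1} u * gauss_weight A (u - v))"

definition cond_v :: "real \<Rightarrow> real \<Rightarrow> real measure" where
  "cond_v A u = prop_density lborel (\<lambda>v. indicator {0..1} v * gauss_weight A (u - v))"

datatype coord = Coord_U | Coord_V

primrec gibbs_update :: "real \<Rightarrow> real \<times> real \<Rightarrow> coord \<Rightarrow> (real \<times> real) measure" where
  "gibbs_update A x Coord_U = distr (cond_u A (snd x)) borel (\<lambda>u'. (u', snd x))"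
| "gibbs_update A x Coord_V = distr (cond_v A (fst x)) borel (\<lambda>v'. (fst x, v'))"

definition gibbs_kernel :: "real \<Rightarrow> real \<times> real \<Rightarrow> (real \<times> real) measure" where
  "gibbs_kernel A x = measure_pmf (pmf_of_set {Coord_U, Coord_V}) \<bind> gibbs_update A x"

definition gibbs_mixing_time :: "real \<Rightarrow> real \<Rightarrow> enat" where
  "gibbs_mixing_time A \<epsilon> = mixing_time borel unit_square (gibbs_kernel A) (diag_dist A) \<epsilon>"

lemma gauss_weight_measurable [measurable]: "gauss_weight A \<in> borel_measurable borel"
  unfolding gauss_weight_def by measurable

lemma prob_space_prop_density:
  assumes [measurable]: "f \<in> borel_measurable M"
    and "(\<integral>\<^sup>+y. ennreal (f y) \<partial>M) \<noteq> 0" "(\<integral>\<^sup>+y. ennreal (f y) \<partial>M) \<noteq> \<infinity>"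
  shows "prob_space (prop_density M f)"
proof
  show "emeasure (prop_density M f) (space (prop_density M f)) = 1"
    using assms(2,3) unfolding prop_density_def
    by (simp add: emeasure_density nn_integral_divide less_top cong: nn_integral_cong)
qed

lemma nn_integral_weight_pos_finite:
  fixes B :: "'a::euclidean_space set"
  assumes [measurable]: "B \<in> sets borel" "g \<in> borel_measurable borel"
    and B: "emeasure lborel B = 1" and g: "\<And>x. 0 < g x" "\<And>x. g x \<le> 1"
  shows "(\<integral>\<^sup>+y. ennreal (indicator B y * g y) \<partial>lborel) \<noteq> 0"
    and "(\<integral>\<^sup>+y. ennreal (indicator B y * g y) \<partial>lborel) \<noteq> \<infinity>"
proof -
  have "\<not> (AE y in lborel. ennreal (indicator B y * g y) = 0)"
  proof
    assume "AE y in lborel. ennreal (indicator B y * g y) = 0"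
    then have "AE y in lborel. y \<notin> B"
      by eventually_elim (use g(1) in \<open>auto simp: indicator_def ennreal_eq_0_iff simp flip: not_less\<close>)
    then have "emeasure lborel B = 0"
      by (subst (asm) AE_iff_measurable[OF _ refl]) auto
    with B show False by simp
  qed
  then show "(\<integral>\<^sup>+y. ennreal (indicator B y * g y) \<partial>lborel) \<noteq> 0"
    by (subst nn_integral_0_iff_AE) auto
  have "(\<integral>\<^sup>+y. ennreal (indicator B y * g y) \<partial>lborel) \<le> (\<integral>\<^sup>+y. indicator B y \<partial>lborel)"
    by (intro nn_integral_mono) (use g in \<open>auto simp: indicator_def\<close>)
  also have "\<dots> = 1" using B by simp
  finally show "(\<integral>\<^sup>+y. ennreal (indicator B y * g y) \<partial>lborel) \<noteq> \<infinity>"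
    by (auto simp: top_unique)
qed

lemma gauss_weight_bounds: "0 < gauss_weight A x" "gauss_weight A x \<le> 1"
  by (auto simp: gauss_weight_def)

lemma prob_space_diag_dist: "prob_space (diag_dist A)"
proof -
  have e: "emeasure lborel unit_square = 1"
    by (simp add: lborel_prod[symmetric] lborel.emeasure_pair_measure_Times)
  have s [measurable]: "unit_square \<in> sets borel"
    by (simp add: borel_prod[symmetric])
  have m [measurable]: "(\<lambda>y. gauss_weight A (fst y - snd y)) \<in> borel_measurable borel"
    by (simp add: borel_prod[symmetric])
  show ?thesis
    unfolding diag_dist_def case_prod_beta prod.collapse
    by (rule prob_space_prop_density)
       (use nn_integral_weight_pos_finite[OF s m e gauss_weight_bounds] in
         \<open>simp_all\<close>)
qed

lemma prob_space_cond_u: "prob_space (cond_u A v)"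
  unfolding cond_u_def
  by (rule prob_space_prop_density, measurable)
     (rule nn_integral_weight_pos_finite; simp add: gauss_weight_bounds)+

lemma prob_space_cond_v: "prob_space (cond_v A u)"
  unfolding cond_v_def
  by (rule prob_space_prop_density, measurable)
     (rule nn_integral_weight_pos_finite; simp add: gauss_weight_bounds)+

lemma sets_cond [simp, measurable_cong]:
  "sets (cond_u A v) = sets borel" "sets (cond_v A u) = sets borel"
  "sets (diag_dist A) = sets borel"
  by (simp_all add: cond_u_def cond_v_def diag_dist_def prop_density_def)

lemma sets_gibbs_update [simp, measurable_cong]: "sets (gibbs_update A x r) = sets borel"
  by (cases r) auto

lemma gibbs_update_measurable [measurable]:
  "(\<lambda>x. gibbs_update A x r) \<in> borel \<rightarrow>\<^sub>M prob_algebra borel"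
proof -
  have [measurable]: "fst \<in> borel_measurable (borel :: (real \<times> real) measure)"
    "snd \<in> borel_measurable (borel :: (real \<times> real) measure)"
    by (simp_all add: borel_prod[symmetric])
  have p: "prob_space (gibbs_update A x r)" for x
    by (cases r)
       (auto intro!: prob_space.prob_space_distr prob_space_cond_u prob_space_cond_v
         simp: borel_prod[symmetric])
  have "(\<lambda>x. gibbs_update A x r) \<in> borel \<rightarrow>\<^sub>M subprob_algebra borel"
  proof (rule measurable_subprob_algebra)
    fix S :: "(real \<times> real) set"
    assume [measurable]: "S \<in> sets borel"
    show "(\<lambda>x. emeasure (gibbs_update A x r) S) \<in> borel_measurable borel"
    proof (cases r)
      case Coord_U
      have "emeasure (gibbs_update A x r) S =
          (\<integral>\<^sup>+u. ennreal (indicator {0..1} u * gauss_weight A (u - snd x)) /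
             (\<integral>\<^sup>+y. ennreal (indicator {0..1} y * gauss_weight A (y - snd x)) \<partial>lborel) *
             indicator S (u, snd x) \<partial>lborel)" for x
        unfolding Coord_U gibbs_update.simps cond_u_def prop_density_def
        by (subst emeasure_distr, (simp; fail), measurable, subst emeasure_density, measurable)
           (auto intro!: nn_integral_cong split: split_indicator)
      then show ?thesis
        by simp measurable
    next
      case Coord_V
      have "emeasure (gibbs_update A x r) S =
          (\<integral>\<^sup>+v. ennreal (indicator {0..1} v * gauss_weight A (fst x - v)) /
             (\<integral>\<^sup>+y. ennreal (indicator {0..1} y * gauss_weight A (fst x - y)) \<partial>lborel) *
             indicator S (fst x, v) \<partial>lborel)" for x
        unfolding Coord_V gibbs_update.simps cond_v_def prop_density_def
        by (subst emeasure_distr, (simp; fail), measurable, subst emeasure_density, measurable)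
           (auto intro!: nn_integral_cong split: split_indicator)
      then show ?thesis
        by simp measurable
    qed
  qed (use p in \<open>auto intro: prob_space_imp_subprob_space\<close>)
  then show ?thesis
    by (intro measurable_prob_algebraI p)
qed

text \<open>\<open>bind\<close> behaves as intended only for measurable kernels.\<close>

lemma gibbs_kernel_measurable: "gibbs_kernel A \<in> borel \<rightarrow>\<^sub>M prob_algebra borel"
proof -
  have "(\<lambda>x. measure_pmf (pmf_of_set {Coord_U, Coord_V}) \<bind> gibbs_update A x)
      \<in> borel \<rightarrow>\<^sub>M prob_algebra borel"
  proof (rule measurable_bind_prob_space2)
    show "(\<lambda>x. measure_pmf (pmf_of_set {Coord_U, Coord_V}))
        \<in> borel \<rightarrow>\<^sub>M prob_algebra (count_space UNIV)"
      by (auto simp: space_prob_algebra measure_pmf.prob_space_axioms)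
    have "gibbs_update A x r =
        (if r = Coord_U then gibbs_update A x Coord_U else gibbs_update A x Coord_V)" for x r
      by (cases r) simp_all
    then have "(\<lambda>(x, r). gibbs_update A x r) =
        (\<lambda>p. if snd p = Coord_U then gibbs_update A (fst p) Coord_U
              else gibbs_update A (fst p) Coord_V)"
      by (metis (no_types, lifting) case_prod_beta)
    also have "\<dots> \<in> borel \<Otimes>\<^sub>M count_space UNIV \<rightarrow>\<^sub>M prob_algebra borel"
      by (intro measurable_If measurable_compose[OF measurable_fst gibbs_update_measurable])
         measurable
    finally show "(\<lambda>(x, r). gibbs_update A x r)
        \<in> borel \<Otimes>\<^sub>M count_space UNIV \<rightarrow>\<^sub>M prob_algebra borel" .
  qed
  then show ?thesis
    by (simp add: gibbs_kernel_def[abs_def])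
qed

lemma chain_law_gibbs:
  "chain_law borel (gibbs_kernel A) x t \<in> space (prob_algebra borel)"
proof (induction t)
  case 0
  then show ?case
    by (simp add: space_prob_algebra prob_space_return)
next
  case (Suc t)
  then show ?case
    using prob_space_bind'[OF Suc gibbs_kernel_measurable] sets_bind'[OF Suc gibbs_kernel_measurable]
    by (simp add: space_prob_algebra)
qed

end

theory Submission
  imports Defs
begin

text \<open>
  Write \<open>P\<close> for the one-dimensional kernel \<open>cond_u A\<close>. A Doeblin minorization for the Gibbs kernel,
  after \<open>O(A^2)\<close> steps and with a constant that does not depend on \<open>A\<close>, implies the theorem.
  Since repeated updates of one coordinate have no further effect, it suffices to minorize
  \<open>P^n\<close> for one \<open>n = O(A^2)\<close>. This is done in two stages. The function \<open>G x = (x (1 - x))^2\<close> is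
  convex near the end points, where moreover \<open>P\<close> pushes inwards, so that
  \<open>P G \<ge> (1 - B / A^2) G + s / A^2\<close>; iterating, after \<open>O(A^2)\<close> steps the chain is in
  \<open>[a, 1 - a]\<close> with probability bounded below. From there, \<open>P\<close> dominates the Gaussian random walk
  killed outside \<open>[0, 1]\<close>, and for a target close to \<open>1 / 2\<close> the free Gaussian density beats the
  contribution of the paths that leave the interval.
\<close>

subsection \<open>Total variation bounds from a minorization\<close>

text \<open>Domination of measures is expressed dually throughout, by integrals of arbitrary
  \<open>ennreal\<close>-valued measurable functions: a minorization becomes one inequality per test
  function, and kernels compose by iterating \<open>kernel_op\<close>, with no integrability
  conditions.

  Two stages are needed because the killed walk cannot serve all starting points. Started at an end
  point, it survives of order A^2 steps only with probability of order 1/A, so the constant would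
  degrade with A. The comparison discards the normalization by \<open>cond_mass\<close>, which near
  the boundary is what keeps the chain inside. The drift argument retains it, but uses only that the
  mean displacement points towards 1/2. This is why G must be convex near the end points: for x (1 -
  x) the negative second derivative would have to be beaten by the size of the drift, which is
  negligible already at a distance of a large multiple of 1/A.

  The number of coordinate changes in a given time is random, so the one-dimensional bound is proved
  for all sufficiently large step counts at once. The numerical constants come from crude moment
  estimates; only their independence of A matters.\<close>

definition kernel_op :: "('a \<Rightarrow> 'b measure) \<Rightarrow> ('b \<Rightarrow> ennreal) \<Rightarrow> 'a \<Rightarrow> ennreal" where
  "kernel_op K f x = (\<integral>\<^sup>+y. f y \<partial>K x)"

lemma kernel_op_measurable:
  assumes K: "K \<in> M \<rightarrow>\<^sub>M prob_algebra N" and f: "f \<in> borel_measurable N"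
  shows "kernel_op K f \<in> borel_measurable M"
proof -
  have "K \<in> M \<rightarrow>\<^sub>M subprob_algebra N"
    using K by (rule measurable_prob_algebraD)
  from measurable_compose[OF this nn_integral_measurable_subprob_algebra[OF f]]
  show ?thesis by (simp add: kernel_op_def[abs_def])
qed

lemma kernel_op_funpow_measurable:
  assumes "K \<in> M \<rightarrow>\<^sub>M prob_algebra M" "f \<in> borel_measurable M"
  shows "(kernel_op K ^^ t) f \<in> borel_measurable M"
  by (induction t) (auto intro: kernel_op_measurable assms)

lemma chain_law_prob_algebra:
  assumes K: "K \<in> M \<rightarrow>\<^sub>M prob_algebra M" and x: "x \<in> space M"
  shows "chain_law M K x t \<in> space (prob_algebra M)"
proof (induction t)
  case 0
  then show ?case using x by (simp add: space_prob_algebra prob_space_return)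
next
  case (Suc t)
  then show ?case
    using prob_space_bind'[OF Suc K] sets_bind'[OF Suc K] by (simp add: space_prob_algebra)
qed

lemma nn_integral_chain_law:
  assumes K: "K \<in> M \<rightarrow>\<^sub>M prob_algebra M" and x: "x \<in> space M"
    and f: "f \<in> borel_measurable M"
  shows "(\<integral>\<^sup>+y. f y \<partial>chain_law M K x t) = (kernel_op K ^^ t) f x"
  using f
proof (induction t arbitrary: f)
  case 0
  then show ?case using x by (simp add: nn_integral_return)
next
  case (Suc t)
  have s: "sets (chain_law M K x t) = sets M"
    using chain_law_prob_algebra[OF K x, of t] by (simp add: space_prob_algebra)
  have K': "K \<in> chain_law M K x t \<rightarrow>\<^sub>M subprob_algebra M"
    using measurable_prob_algebraD[OF K] by (simp add: measurable_cong_sets[OF s refl])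
  have "(\<integral>\<^sup>+y. f y \<partial>chain_law M K x (Suc t)) = (\<integral>\<^sup>+y. kernel_op K f y \<partial>chain_law M K x t)"
    by (simp add: nn_integral_bind[OF Suc.prems K'] kernel_op_def)
  also have "\<dots> = (kernel_op K ^^ t) (kernel_op K f) x"
    by (rule Suc.IH) (rule kernel_op_measurable[OF K Suc.prems])
  finally show ?case by (simp add: funpow_swap1)
qed

text \<open>Apply the minorization to the two nonnegative functions \<open>f - C\<close> and
  \<open>C + d - f\<close>. Both resulting bounds involve \<open>\<nu>\<close> but not
  \<open>\<rho>\<close>, so they are common to all starting points, and they differ by only
  \<open>(1 - c) * d\<close>: the oscillation contracts by the factor 1 - c.\<close>

lemma doeblin_step:
  fixes f :: "'a \<Rightarrow> real"
  assumes "prob_space \<rho>" "prob_space \<nu>" and s: "sets \<rho> = sets M" "sets \<nu> = sets M"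
    and minor: "\<And>g. g \<in> borel_measurable M \<Longrightarrow> ennreal c * (\<integral>\<^sup>+y. g y \<partial>\<nu>) \<le> (\<integral>\<^sup>+y. g y \<partial>\<rho>)"
    and c: "0 \<le> c" and f: "f \<in> borel_measurable M"
    and b: "\<And>x. x \<in> space M \<Longrightarrow> C \<le> f x" "\<And>x. x \<in> space M \<Longrightarrow> f x \<le> C + d"
  shows "(1 - c) * C + c * (\<integral>x. f x \<partial>\<nu>) \<le> (\<integral>x. f x \<partial>\<rho>)"
    and "(\<integral>x. f x \<partial>\<rho>) \<le> (1 - c) * C + c * (\<integral>x. f x \<partial>\<nu>) + (1 - c) * d"
proof -
  interpret R: prob_space \<rho> by fact
  interpret N: prob_space \<nu> by fact
  have sp: "space \<rho> = space M" "space \<nu> = space M" using s by (auto dest: sets_eq_imp_space_eq)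
  have fm: "f \<in> borel_measurable \<rho>" "f \<in> borel_measurable \<nu>"
    using f by (simp_all add: measurable_cong_sets[OF s(1) refl] measurable_cong_sets[OF s(2) refl])
  have bd: "\<bar>f x\<bar> \<le> \<bar>C\<bar> + \<bar>C + d\<bar>" if "x \<in> space M" for x
    using b[OF that] by linarith
  have fi: "integrable \<rho> f" "integrable \<nu> f"
    by (intro R.integrable_const_bound[where B="\<bar>C\<bar> + \<bar>C + d\<bar>"]
        N.integrable_const_bound[where B="\<bar>C\<bar> + \<bar>C + d\<bar>"] fm; use bd sp in \<open>auto simp: AE_I2\<close>)+
  have key: "c * (\<integral>x. g x \<partial>\<nu>) \<le> (\<integral>x. g x \<partial>\<rho>)"
    if g: "integrable \<rho> g" "integrable \<nu> g" "g \<in> borel_measurable M" "\<And>x. x \<in> space M \<Longrightarrow> 0 \<le> g x" for g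
  proof -
    have nn: "AE x in \<rho>. 0 \<le> g x" "AE x in \<nu>. 0 \<le> g x"
      using g(4) sp by (auto intro!: AE_I2)
    have "ennreal (c * (\<integral>x. g x \<partial>\<nu>)) = ennreal c * (\<integral>\<^sup>+x. ennreal (g x) \<partial>\<nu>)"
      using c by (simp add: nn_integral_eq_integral[OF g(2) nn(2)] ennreal_mult' integral_nonneg_AE nn)
    also have "\<dots> \<le> (\<integral>\<^sup>+x. ennreal (g x) \<partial>\<rho>)"
      by (rule minor) (use g(3) in measurable)
    also have "\<dots> = ennreal (\<integral>x. g x \<partial>\<rho>)"
      by (rule nn_integral_eq_integral[OF g(1) nn(1)])
    finally show ?thesis
      using integral_nonneg_AE[OF nn(1)] by (simp add: ennreal_le_iff)
  qed
  have "c * (\<integral>x. f x - C \<partial>\<nu>) \<le> (\<integral>x. f x - C \<partial>\<rho>)"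
    using fi f b by (intro key) auto
  then show "(1 - c) * C + c * (\<integral>x. f x \<partial>\<nu>) \<le> (\<integral>x. f x \<partial>\<rho>)"
    using fi by (simp add: R.prob_space N.prob_space algebra_simps)
  have "c * (\<integral>x. (C + d) - f x \<partial>\<nu>) \<le> (\<integral>x. (C + d) - f x \<partial>\<rho>)"
    using fi f b by (intro key) auto
  then show "(\<integral>x. f x \<partial>\<rho>) \<le> (1 - c) * C + c * (\<integral>x. f x \<partial>\<nu>) + (1 - c) * d"
    using fi by (simp add: R.prob_space N.prob_space algebra_simps)
qed

text \<open>For a fixed event S, follow y to the probability of S at time \<open>k * N\<close> from
  y. By \<open>doeblin_step\<close> its range lies in an interval of length
  \<open>(1 - c) ^ k\<close>. Stationarity makes the \<open>\<pi>\<close>-measure of S an average of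
  these values, hence a point of the same interval. No coupling is constructed.\<close>

lemma doeblin_tv_bound:
  assumes K: "K \<in> M \<rightarrow>\<^sub>M prob_algebra M"
    and \<nu>: "prob_space \<nu>" "sets \<nu> = sets M"
    and \<pi>: "prob_space \<pi>" "sets \<pi> = sets M"
    and stat: "\<And>f. f \<in> borel_measurable M \<Longrightarrow> (\<integral>\<^sup>+x. kernel_op K f x \<partial>\<pi>) = (\<integral>\<^sup>+x. f x \<partial>\<pi>)"
    and minor: "\<And>f x. f \<in> borel_measurable M \<Longrightarrow> x \<in> space M \<Longrightarrow>
      ennreal c * (\<integral>\<^sup>+y. f y \<partial>\<nu>) \<le> (kernel_op K ^^ N) f x"
    and c: "0 \<le> c" and x: "x \<in> space M"
  shows "tv_dist (chain_law M K x (k * N)) \<pi> \<le> (1 - c) ^ k"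
  unfolding tv_dist_def
proof (rule cSUP_least)
  let ?L = "\<lambda>x t. chain_law M K x t"
  have pa: "prob_space (?L x t)" and s: "sets (?L x t) = sets M" if "x \<in> space M" for x t
    using chain_law_prob_algebra[OF K that, of t] by (auto simp: space_prob_algebra)
  show "sets (?L x (k * N)) \<noteq> {}" by auto
  fix S assume "S \<in> sets (?L x (k * N))"
  then have S [measurable]: "S \<in> sets M" using s x by simp
  define F where "F t y = measure (?L y t) S" for t y
  have em: "ennreal (F t y) = (kernel_op K ^^ t) (indicator S) y" if "y \<in> space M" for t y
  proof -
    interpret prob_space "?L y t" by (rule pa[OF that])
    have "ennreal (F t y) = emeasure (?L y t) S" by (simp add: F_def emeasure_eq_measure)
    also have "\<dots> = (\<integral>\<^sup>+z. indicator S z \<partial>?L y t)" using S s[OF that] by simp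
    finally show ?thesis by (simp add: nn_integral_chain_law[OF K that])
  qed
  have Fm: "F t \<in> borel_measurable M" for t
  proof -
    have "(\<lambda>y. enn2real ((kernel_op K ^^ t) (indicator S) y)) \<in> borel_measurable M"
      using kernel_op_funpow_measurable[OF K, of "indicator S" t] by measurable
    moreover have "enn2real ((kernel_op K ^^ t) (indicator S) y) = F t y" if "y \<in> space M" for y
      using em[OF that, of t, symmetric] by (simp add: F_def)
    ultimately show ?thesis by (simp cong: measurable_cong)
  qed
  have F01: "0 \<le> F t y" "F t y \<le> 1" if "y \<in> space M" for t y
    using prob_space.prob_le_1[OF pa[OF that]] by (auto simp: F_def)
  have Fint: "(\<integral>\<^sup>+y. (kernel_op K ^^ t) (indicator S) y \<partial>\<rho>) = ennreal (\<integral>y. F t y \<partial>\<rho>)"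
    if \<rho>: "prob_space \<rho>" "sets \<rho> = sets M" for \<rho> t
  proof -
    interpret prob_space \<rho> by fact
    have sp: "space \<rho> = space M" using \<rho>(2) by (rule sets_eq_imp_space_eq)
    have "(\<integral>\<^sup>+y. (kernel_op K ^^ t) (indicator S) y \<partial>\<rho>) = (\<integral>\<^sup>+y. ennreal (F t y) \<partial>\<rho>)"
      by (intro nn_integral_cong) (simp add: em sp)
    also have "\<dots> = ennreal (\<integral>y. F t y \<partial>\<rho>)"
    proof (rule nn_integral_eq_integral)
      show "integrable \<rho> (F t)"
        by (rule integrable_const_bound[where B=1])
          (use F01 Fm sp in \<open>auto simp: measurable_cong_sets[OF \<rho>(2) refl]\<close>)
    qed (use F01 sp in auto)
    finally show ?thesis .
  qed
  have rec: "F (N + t) y = (\<integral>z. F t z \<partial>?L y N)" if "y \<in> space M" for t y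
  proof -
    have "ennreal (F (N + t) y) = (kernel_op K ^^ N) ((kernel_op K ^^ t) (indicator S)) y"
      by (simp add: em[OF that] funpow_add)
    also have "\<dots> = (\<integral>\<^sup>+z. (kernel_op K ^^ t) (indicator S) z \<partial>?L y N)"
      by (rule nn_integral_chain_law[OF K that, symmetric])
        (rule kernel_op_funpow_measurable[OF K], simp)
    also have "\<dots> = ennreal (\<integral>z. F t z \<partial>?L y N)"
      by (rule Fint[OF pa[OF that] s[OF that]])
    finally show ?thesis
      using F01[OF that] F01 sets_eq_imp_space_eq[OF s[OF that]]
      by (subst (asm) ennreal_inj) (auto intro!: integral_nonneg_AE)
  qed
  have "\<exists>C. \<forall>y\<in>space M. C \<le> F (k * N) y \<and> F (k * N) y \<le> C + (1 - c) ^ k"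
  proof (induction k)
    case 0
    show ?case by (rule exI[of _ 0]) (use F01 in auto)
  next
    case (Suc k)
    then obtain C where C: "\<And>y. y \<in> space M \<Longrightarrow> C \<le> F (k * N) y"
      "\<And>y. y \<in> space M \<Longrightarrow> F (k * N) y \<le> C + (1 - c) ^ k" by blast
    have "(1 - c) * C + c * (\<integral>x. F (k * N) x \<partial>\<nu>) \<le> F (Suc k * N) y \<and>
        F (Suc k * N) y \<le> (1 - c) * C + c * (\<integral>x. F (k * N) x \<partial>\<nu>) + (1 - c) * (1 - c) ^ k"
      if y: "y \<in> space M" for y
    proof -
      have "ennreal c * (\<integral>\<^sup>+z. g z \<partial>\<nu>) \<le> (\<integral>\<^sup>+z. g z \<partial>?L y N)" if "g \<in> borel_measurable M" for g
        using minor[OF that y] by (simp add: nn_integral_chain_law[OF K y that])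
      from doeblin_step[OF pa[OF y] \<nu>(1) s[OF y] \<nu>(2) this c Fm C]
      show ?thesis by (simp add: rec[OF y])
    qed
    then show ?case by auto
  qed
  then obtain C where C: "\<And>y. y \<in> space M \<Longrightarrow> C \<le> F (k * N) y"
      "\<And>y. y \<in> space M \<Longrightarrow> F (k * N) y \<le> C + (1 - c) ^ k" by blast
  interpret P: prob_space \<pi> by fact
  have sp: "space \<pi> = space M" using \<pi>(2) by (rule sets_eq_imp_space_eq)
  have "(\<integral>\<^sup>+y. (kernel_op K ^^ t) (indicator S) y \<partial>\<pi>) = (\<integral>\<^sup>+y. indicator S y \<partial>\<pi>)" for t
    by (induction t) (simp_all add: stat kernel_op_funpow_measurable[OF K])
  then have "ennreal (measure \<pi> S) = ennreal (\<integral>y. F (k * N) y \<partial>\<pi>)"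
    using Fint[OF \<pi>, of "k * N"] S \<pi>(2) by (simp add: P.emeasure_eq_measure)
  then have e: "measure \<pi> S = (\<integral>y. F (k * N) y \<partial>\<pi>)"
    using F01 sp by (subst (asm) ennreal_inj) (auto intro!: integral_nonneg_AE)
  have i: "integrable \<pi> (F (k * N))"
    by (rule P.integrable_const_bound[where B=1])
      (use F01 Fm sp in \<open>auto simp: measurable_cong_sets[OF \<pi>(2) refl]\<close>)
  have "C \<le> (\<integral>y. F (k * N) y \<partial>\<pi>)"
    by (rule P.integral_ge_const[OF i]) (use C sp in auto)
  moreover have "(\<integral>y. F (k * N) y \<partial>\<pi>) \<le> C + (1 - c) ^ k"
    by (rule P.integral_le_const[OF i]) (use C sp in auto)
  ultimately show "\<bar>measure (?L x (k * N)) S - measure \<pi> S\<bar> \<le> (1 - c) ^ k"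
    using C[OF x] e by (simp add: F_def[symmetric])
qed

subsection \<open>Reduction to one coordinate\<close>

lemma kernel_op_cmult:
  assumes "K \<in> M \<rightarrow>\<^sub>M prob_algebra N" "x \<in> space M" "f \<in> borel_measurable N"
  shows "kernel_op K (\<lambda>y. c * f y) x = c * kernel_op K f x"
proof -
  have "sets (K x) = sets N"
    using measurable_space[OF assms(1,2)] by (simp add: space_prob_algebra)
  then show ?thesis
    using assms(3) by (simp add: kernel_op_def nn_integral_cmult cong: measurable_cong_sets)
qed

lemma kernel_op_add:
  assumes "K \<in> M \<rightarrow>\<^sub>M prob_algebra N" "x \<in> space M"
    and "f \<in> borel_measurable N" "g \<in> borel_measurable N"
  shows "kernel_op K (\<lambda>y. f y + g y) x = kernel_op K f x + kernel_op K g x"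
proof -
  have "sets (K x) = sets N"
    using measurable_space[OF assms(1,2)] by (simp add: space_prob_algebra)
  then show ?thesis
    using assms(3,4) by (simp add: kernel_op_def nn_integral_add cong: measurable_cong_sets)
qed

lemma kernel_op_const:
  assumes "K \<in> M \<rightarrow>\<^sub>M prob_algebra N" "x \<in> space M"
  shows "kernel_op K (\<lambda>y. c) x = c"
proof -
  have "prob_space (K x)"
    using measurable_space[OF assms] by (simp add: space_prob_algebra)
  then show ?thesis
    by (simp add: kernel_op_def prob_space.emeasure_space_1)
qed

lemma gauss_weight_minus: "gauss_weight A (- x) = gauss_weight A x"
  by (simp add: gauss_weight_def)

lemma cond_v_eq: "cond_v A = cond_u A"
proof
  fix u
  have "gauss_weight A (u - v) = gauss_weight A (v - u)" for v
    using gauss_weight_minus[of A "v - u"] by simp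
  then show "cond_v A u = cond_u A u"
    by (simp add: cond_u_def cond_v_def)
qed

definition cond_mass :: "real \<Rightarrow> real \<Rightarrow> ennreal" where
  "cond_mass A x = (\<integral>\<^sup>+y. ennreal (indicator {0..1} y * gauss_weight A (y - x)) \<partial>lborel)"

lemma cond_mass_finite: "cond_mass A x \<noteq> 0" "cond_mass A x \<noteq> \<infinity>"
  unfolding cond_mass_def
  by (rule nn_integral_weight_pos_finite; simp add: gauss_weight_bounds)+

lemma cond_u_density:
  "cond_u A x = density lborel (\<lambda>y. ennreal (indicator {0..1} y * gauss_weight A (y - x)) / cond_mass A x)"
  by (simp add: cond_u_def prop_density_def cond_mass_def)

lemma nn_integral_cond_u:
  assumes [measurable]: "f \<in> borel_measurable borel"
  shows "(\<integral>\<^sup>+y. f y \<partial>cond_u A x) =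
    (\<integral>\<^sup>+y. ennreal (indicator {0..1} y * gauss_weight A (y - x)) * f y \<partial>lborel) / cond_mass A x"
proof -
  have "(\<integral>\<^sup>+y. f y \<partial>cond_u A x) =
      (\<integral>\<^sup>+y. ennreal (indicator {0..1} y * gauss_weight A (y - x)) / cond_mass A x * f y \<partial>lborel)"
    unfolding cond_u_density by (subst nn_integral_density) auto
  also have "\<dots> = (\<integral>\<^sup>+y. ennreal (indicator {0..1} y * gauss_weight A (y - x)) * f y / cond_mass A x \<partial>lborel)"
    by (simp add: divide_ennreal_def mult_ac)
  also have "\<dots> = (\<integral>\<^sup>+y. ennreal (indicator {0..1} y * gauss_weight A (y - x)) * f y \<partial>lborel) / cond_mass A x"
    by (rule nn_integral_divide) measurable
  finally show ?thesis .
qed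

lemma cond_mass_measurable [measurable]: "cond_mass A \<in> borel_measurable borel"
  unfolding cond_mass_def[abs_def] by measurable

lemma cond_u_measurable: "cond_u A \<in> borel \<rightarrow>\<^sub>M prob_algebra borel"
proof (intro measurable_prob_algebraI prob_space_cond_u measurable_subprob_algebra)
  fix S :: "real set" assume [measurable]: "S \<in> sets borel"
  have "emeasure (cond_u A x) S =
      (\<integral>\<^sup>+y. ennreal (indicator {0..1} y * gauss_weight A (y - x)) * indicator S y \<partial>lborel) / cond_mass A x" for x
    using nn_integral_cond_u[of "indicator S" A x] by simp
  then show "(\<lambda>x. emeasure (cond_u A x) S) \<in> borel_measurable borel"
    by (subst measurable_cong) auto
qed (auto intro: prob_space_imp_subprob_space prob_space_cond_u)

text \<open>Holds because \<open>cond_u\<close> is concentrated on the unit interval. The point x is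
  an arbitrary real, so one application carries a bound from the unit interval to the whole
  line.\<close>

lemma kernel_op_cond_u_mono:
  assumes "\<And>y. y \<in> {0..1} \<Longrightarrow> f y \<le> g y"
  shows "kernel_op (cond_u A) f x \<le> kernel_op (cond_u A) g x"
  unfolding kernel_op_def cond_u_density
proof (intro nn_integral_mono_AE)
  show "AE y in density lborel (\<lambda>y. ennreal (indicator {0..1} y * gauss_weight A (y - x)) / cond_mass A x). f y \<le> g y"
    by (subst AE_density) (use assms in \<open>auto split: split_indicator\<close>)
qed

lemma kernel_op_cond_u_funpow_mono:
  assumes "\<And>y. y \<in> {0..1} \<Longrightarrow> f y \<le> g y" and "x \<in> {0..1}"
  shows "(kernel_op (cond_u A) ^^ n) f x \<le> (kernel_op (cond_u A) ^^ n) g x"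
  using assms(2)
proof (induction n arbitrary: x)
  case (Suc n)
  show ?case
    unfolding funpow.simps comp_def by (rule kernel_op_cond_u_mono) (rule Suc.IH)
qed (use assms(1) in simp)

section \<open>Averaging over one coordinate of the plane\<close>

text \<open>The argument is only the coordinate that is kept, since the update forgets the other
  one. As functions on the line, \<open>op_u A f\<close> and \<open>op_v A f\<close> can be fed to
  powers of \<open>kernel_op (cond_u A)\<close>, one power per change of coordinate.\<close>

definition op_u :: "real \<Rightarrow> (real \<times> real \<Rightarrow> ennreal) \<Rightarrow> real \<Rightarrow> ennreal" where
  "op_u A f v = kernel_op (cond_u A) (\<lambda>u. f (u, v)) v"

definition op_v :: "real \<Rightarrow> (real \<times> real \<Rightarrow> ennreal) \<Rightarrow> real \<Rightarrow> ennreal" where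
  "op_v A f u = kernel_op (cond_u A) (\<lambda>v. f (u, v)) u"

lemma borel_pair_measurable [measurable]:
  "fst \<in> borel_measurable (borel :: (real \<times> real) measure)"
  "snd \<in> borel_measurable (borel :: (real \<times> real) measure)"
  by (simp_all add: borel_prod[symmetric])

lemma op_measurable [measurable]:
  assumes f: "f \<in> borel_measurable borel"
  shows "op_u A f \<in> borel_measurable borel" "op_v A f \<in> borel_measurable borel"
proof -
  have f' [measurable]: "f \<in> borel_measurable (borel \<Otimes>\<^sub>M borel)"
    using f by (simp add: borel_prod)
  note K = measurable_prob_algebraD[OF cond_u_measurable]
  have "(\<lambda>v. \<integral>\<^sup>+u. f (u, v) \<partial>cond_u A v) \<in> borel_measurable borel"
    by (rule nn_integral_measurable_subprob_algebra2[OF _ K]) measurable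
  then show "op_u A f \<in> borel_measurable borel"
    by (simp add: op_u_def[abs_def] kernel_op_def)
  have "(\<lambda>v. \<integral>\<^sup>+u. f (v, u) \<partial>cond_u A v) \<in> borel_measurable borel"
    by (rule nn_integral_measurable_subprob_algebra2[OF _ K]) measurable
  then show "op_v A f \<in> borel_measurable borel"
    by (simp add: op_v_def[abs_def] kernel_op_def)
qed

lemma kernel_op_gibbs:
  assumes f: "f \<in> borel_measurable borel"
  shows "kernel_op (gibbs_kernel A) f (u, v) = (op_u A f v + op_v A f u) / 2"
proof -
  have "gibbs_update A (u, v) r \<in> space (subprob_algebra borel)" for r
    by (rule measurable_space[OF measurable_prob_algebraD[OF gibbs_update_measurable]]) simp
  then have G: "gibbs_update A (u, v) \<in> measure_pmf (pmf_of_set {Coord_U, Coord_V}) \<rightarrow>\<^sub>M subprob_algebra borel"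
    by (simp add: measurable_def Pi_iff)
  have "kernel_op (gibbs_kernel A) f (u, v) =
      (\<integral>\<^sup>+r. (\<integral>\<^sup>+y. f y \<partial>gibbs_update A (u, v) r) \<partial>pmf_of_set {Coord_U, Coord_V})"
    unfolding kernel_op_def gibbs_kernel_def by (rule nn_integral_bind[OF f G])
  also have "\<dots> = ((\<integral>\<^sup>+y. f y \<partial>gibbs_update A (u, v) Coord_U) + (\<integral>\<^sup>+y. f y \<partial>gibbs_update A (u, v) Coord_V)) / 2"
    by (subst nn_integral_pmf_of_set) auto
  also have "(\<integral>\<^sup>+y. f y \<partial>gibbs_update A (u, v) Coord_U) = op_u A f v"
    unfolding op_u_def kernel_op_def gibbs_update.simps
    by (subst nn_integral_distr) (use f in \<open>auto simp: borel_prod[symmetric]\<close>)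
  also have "(\<integral>\<^sup>+y. f y \<partial>gibbs_update A (u, v) Coord_V) = op_v A f u"
    unfolding op_v_def kernel_op_def gibbs_update.simps cond_v_eq
    by (subst nn_integral_distr) (use f in \<open>auto simp: borel_prod[symmetric]\<close>)
  finally show ?thesis .
qed

lemma kernel_op_mean:
  fixes f g :: "'b \<Rightarrow> ennreal"
  assumes "K \<in> M \<rightarrow>\<^sub>M prob_algebra N" "x \<in> space M"
    and "f \<in> borel_measurable N" "g \<in> borel_measurable N"
  shows "kernel_op K (\<lambda>y. (f y + g y) / 2) x = (kernel_op K f x + kernel_op K g x) / 2"
  using kernel_op_cmult[OF assms(1,2), of "\<lambda>y. f y + g y" "1/2"] kernel_op_add[OF assms] assms(3,4)
  by (simp add: divide_ennreal_def mult.commute)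

text \<open>Only the first of several consecutive updates of the same coordinate matters, so the
  two-dimensional chain reduces to a lazy version of the one-dimensional chain with kernel \<open>cond_u\<close>.\<close>

lemma op_gibbs:
  assumes [measurable]: "f \<in> borel_measurable borel"
  shows "op_u A (kernel_op (gibbs_kernel A) f) v = (op_u A f v + kernel_op (cond_u A) (op_v A f) v) / 2"
    and "op_v A (kernel_op (gibbs_kernel A) f) u = (op_v A f u + kernel_op (cond_u A) (op_u A f) u) / 2"
proof -
  have "op_u A (kernel_op (gibbs_kernel A) f) v = kernel_op (cond_u A) (\<lambda>u. (op_u A f v + op_v A f u) / 2) v"
    by (simp add: op_u_def kernel_op_gibbs)
  also have "\<dots> = (op_u A f v + kernel_op (cond_u A) (op_v A f) v) / 2"
    by (subst kernel_op_mean[OF cond_u_measurable]) (auto simp: kernel_op_const[OF cond_u_measurable])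
  finally show "op_u A (kernel_op (gibbs_kernel A) f) v = (op_u A f v + kernel_op (cond_u A) (op_v A f) v) / 2" .
  have "op_v A (kernel_op (gibbs_kernel A) f) u = kernel_op (cond_u A) (\<lambda>v. (op_v A f u + op_u A f v) / 2) u"
    by (simp add: op_v_def kernel_op_gibbs add.commute)
  also have "\<dots> = (op_v A f u + kernel_op (cond_u A) (op_u A f) u) / 2"
    by (subst kernel_op_mean[OF cond_u_measurable]) (auto simp: kernel_op_const[OF cond_u_measurable])
  finally show "op_v A (kernel_op (gibbs_kernel A) f) u = (op_v A f u + kernel_op (cond_u A) (op_u A f) u) / 2" .
qed

lemma funpow_cond_u_measurable:
  assumes "f \<in> borel_measurable borel"
  shows "(kernel_op (cond_u A) ^^ n) f \<in> borel_measurable borel"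
  by (rule kernel_op_funpow_measurable[OF cond_u_measurable assms])

lemma funpow_cond_u_const: "(kernel_op (cond_u A) ^^ n) (\<lambda>_. c) = (\<lambda>_. c)"
  by (induction n) (auto simp: kernel_op_const[OF cond_u_measurable])

lemma funpow_cond_u_mean:
  assumes "f \<in> borel_measurable borel" "g \<in> borel_measurable borel"
  shows "(kernel_op (cond_u A) ^^ n) (\<lambda>y. (f y + g y) / 2) =
    (\<lambda>x. ((kernel_op (cond_u A) ^^ n) f x + (kernel_op (cond_u A) ^^ n) g x) / 2)"
  by (induction n)
    (auto simp: kernel_op_mean[OF cond_u_measurable] funpow_cond_u_measurable[OF assms(1)]
      funpow_cond_u_measurable[OF assms(2)])

lemma funpow_cond_u_add:
  assumes "f \<in> borel_measurable borel" "g \<in> borel_measurable borel"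
  shows "(kernel_op (cond_u A) ^^ n) (\<lambda>y. f y + g y) =
    (\<lambda>x. (kernel_op (cond_u A) ^^ n) f x + (kernel_op (cond_u A) ^^ n) g x)"
  by (induction n)
    (auto simp: kernel_op_add[OF cond_u_measurable] funpow_cond_u_measurable[OF assms(1)]
      funpow_cond_u_measurable[OF assms(2)])

lemma funpow_cond_u_cmult:
  assumes "f \<in> borel_measurable borel"
  shows "(kernel_op (cond_u A) ^^ n) (\<lambda>y. c * f y) = (\<lambda>x. c * (kernel_op (cond_u A) ^^ n) f x)"
  by (induction n)
    (auto simp: kernel_op_cmult[OF cond_u_measurable] funpow_cond_u_measurable[OF assms(1)])

section \<open>Counting coordinate changes under random updates\<close>

lemma half_add_self_ennreal: "(x + x) / 2 = (x :: ennreal)"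
  by (simp add: mult_2_right[symmetric] mult_divide_eq_ennreal)

lemma half_ennreal: "x / 2 = x * ennreal (1 / 2)"
  by (simp add: divide_ennreal_def)

text \<open>The reals a and b may be negative, in which case \<open>ennreal\<close> truncates them
  to 0. Convexity of the positive part lets the bounds be averaged all the same.\<close>

lemma half_sum_ennreal_ge:
  assumes "\<kappa> * ennreal a \<le> x" "\<kappa> * ennreal b \<le> y"
  shows "\<kappa> * ennreal ((a + b) / 2) \<le> (x + y) / (2::ennreal)"
proof -
  have "ennreal ((a + b) / 2) \<le> ennreal ((max 0 a + max 0 b) / 2)"
    by (intro ennreal_leI) auto
  also have "\<dots> = ennreal (max 0 a + max 0 b) * ennreal (1 / 2)"
    by (subst ennreal_mult[symmetric]) auto
  also have "\<dots> = (ennreal a + ennreal b) / 2"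
    by (simp add: half_ennreal max_def ennreal_neg)
  finally have "\<kappa> * ennreal ((a + b) / 2) \<le> \<kappa> * ((ennreal a + ennreal b) / 2)"
    by (rule mult_left_mono) simp
  also have "\<dots> = (\<kappa> * ennreal a + \<kappa> * ennreal b) / 2"
    by (simp add: ennreal_times_divide distrib_left)
  also have "\<dots> \<le> (x + y) / 2"
    by (intro divide_right_mono_ennreal add_mono assms)
  finally show ?thesis .
qed

text \<open>The number \<open>j\<close> of coordinate changes among \<open>t\<close> further updates is binomial, and
  \<open>2^n * (3/4)^t = 2^n * E (2^-j)\<close> bounds the probability that \<open>j < n\<close>.\<close>

lemma lazy_lower_bound:
  assumes [measurable]: "f \<in> borel_measurable borel"
    and \<kappa>: "\<And>m x. n \<le> m \<Longrightarrow> \<kappa> \<le> (kernel_op (cond_u A) ^^ m) (op_u A f) x"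
      "\<And>m x. n \<le> m \<Longrightarrow> \<kappa> \<le> (kernel_op (cond_u A) ^^ m) (op_v A f) x"
  shows "\<kappa> * ennreal (1 - 2 ^ n / 2 ^ i * (3 / 4) ^ t)
      \<le> (kernel_op (cond_u A) ^^ i) (op_u A ((kernel_op (gibbs_kernel A) ^^ t) f)) x \<and>
    \<kappa> * ennreal (1 - 2 ^ n / 2 ^ i * (3 / 4) ^ t)
      \<le> (kernel_op (cond_u A) ^^ i) (op_v A ((kernel_op (gibbs_kernel A) ^^ t) f)) x"
proof (induction t arbitrary: i x)
  case 0
  show ?case
  proof (cases "n \<le> i")
    case True
    have "\<kappa> * ennreal (1 - 2 ^ n / 2 ^ i * (3 / 4) ^ 0) \<le> \<kappa> * 1"
      by (intro mult_left_mono) auto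
    then show ?thesis using \<kappa>[OF True] by (simp add: order_trans)
  next
    \<comment> \<open>With fewer than n changes nothing is claimed: the real factor is at most 0 and
      \<open>ennreal\<close> sends it to 0.\<close>
    case False
    then have "(2::real) ^ i \<le> 2 ^ n" by simp
    then have "1 - 2 ^ n / 2 ^ i * (3 / 4) ^ 0 \<le> (0::real)" by simp
    then have "ennreal (1 - 2 ^ n / 2 ^ i * (3 / 4) ^ 0) = 0" by (rule ennreal_neg)
    then show ?thesis by simp
  qed
next
  case (Suc t)
  define g where "g = (kernel_op (gibbs_kernel A) ^^ t) f"
  have g [measurable]: "g \<in> borel_measurable borel"
    unfolding g_def by (rule kernel_op_funpow_measurable[OF gibbs_kernel_measurable]) simp
  note gg = Suc.IH[folded g_def]
  \<comment> \<open>Half of the time the next update repeats the coordinate and leaves i unchanged;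
    otherwise i grows by 1 and the subtracted term is halved. This is 3/4 = (1 + 1/2) / 2.\<close>
  have e: "1 - 2 ^ n / 2 ^ i * (3 / 4) ^ Suc t =
      ((1 - 2 ^ n / 2 ^ i * (3 / 4) ^ t) + (1 - 2 ^ n / 2 ^ Suc i * (3 / 4) ^ t)) / (2::real)"
    by (simp add: field_simps)
  have u: "(kernel_op (cond_u A) ^^ i) (op_u A (kernel_op (gibbs_kernel A) g)) x =
      ((kernel_op (cond_u A) ^^ i) (op_u A g) x + (kernel_op (cond_u A) ^^ Suc i) (op_v A g) x) / 2"
    unfolding op_gibbs(1)[OF g, abs_def]
    by (subst funpow_cond_u_mean)
      (auto simp: funpow_swap1 intro!: kernel_op_measurable[OF cond_u_measurable])
  have v: "(kernel_op (cond_u A) ^^ i) (op_v A (kernel_op (gibbs_kernel A) g)) x =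
      ((kernel_op (cond_u A) ^^ i) (op_v A g) x + (kernel_op (cond_u A) ^^ Suc i) (op_u A g) x) / 2"
    unfolding op_gibbs(2)[OF g, abs_def]
    by (subst funpow_cond_u_mean)
      (auto simp: funpow_swap1 intro!: kernel_op_measurable[OF cond_u_measurable])
  have "(kernel_op (gibbs_kernel A) ^^ Suc t) f = kernel_op (gibbs_kernel A) g"
    by (simp add: g_def)
  then show ?case
    unfolding e
    by (simp only: u v) (intro conjI half_sum_ennreal_ge gg[THEN conjunct1] gg[THEN conjunct2])
qed

text \<open>Of the 4 n + 2 updates, the last one resamples u with probability 1/2, whichever
  coordinate was resampled before, so a hypothesis on \<open>op_u\<close> alone suffices at the cost
  of a factor 1/2. The first one turns the starting point into \<open>op_u\<close> or
  \<open>op_v\<close>. The 4 n updates between supply n coordinate changes with probability at least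
  1 - (2 * (3/4)^4)^n = 1 - (81/128)^n, which is at least 1/3 as n is positive.\<close>

lemma gibbs_lower_bound:
  assumes f [measurable]: "f \<in> borel_measurable borel"
    and \<kappa>: "\<And>m x. n \<le> m \<Longrightarrow> \<kappa> \<le> (kernel_op (cond_u A) ^^ m) (op_u A f) x"
    and n: "1 \<le> n"
  shows "\<kappa> * ennreal (1 / 6) \<le> (kernel_op (gibbs_kernel A) ^^ (4 * n + 2)) f x"
proof -
  let ?T = "kernel_op (gibbs_kernel A)"
  have m: "?T f \<in> borel_measurable borel"
    by (rule kernel_op_measurable[OF gibbs_kernel_measurable f])
  have P [measurable]: "kernel_op (cond_u A) (op_u A f) \<in> borel_measurable borel"
      "kernel_op (cond_u A) (op_v A f) \<in> borel_measurable borel"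
    by (auto intro!: kernel_op_measurable[OF cond_u_measurable])
  have half: "\<kappa> / 2 \<le> (a + b) / 2" if "\<kappa> \<le> a" for a b :: ennreal
    by (intro divide_right_mono_ennreal add_increasing2 that) auto
  have u: "\<kappa> / 2 \<le> (kernel_op (cond_u A) ^^ m) (op_u A (?T f)) x" if "n \<le> m" for m x
    unfolding op_gibbs(1)[OF f, abs_def]
    by (subst funpow_cond_u_mean) (use \<kappa>[OF that] in \<open>auto intro!: half\<close>)
  have v: "\<kappa> / 2 \<le> (kernel_op (cond_u A) ^^ m) (op_v A (?T f)) x" if "n \<le> m" for m x
    unfolding op_gibbs(2)[OF f, abs_def] add.commute[of "op_v A f _"]
    by (subst funpow_cond_u_mean)
      (use \<kappa>[of "Suc m" x] that in \<open>auto intro!: half simp: funpow_swap1\<close>)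
  let ?g = "(?T ^^ (4 * n)) (?T f)"
  have "?g \<in> borel_measurable borel"
    by (rule kernel_op_funpow_measurable[OF gibbs_kernel_measurable m])
  note T = kernel_op_gibbs[OF this]
  obtain p q where x: "x = (p, q)" by (cases x)
  let ?c = "1 - 2 ^ n / 2 ^ 0 * (3 / 4) ^ (4 * n) :: real"
  have "?c = 1 - (81 / 128) ^ n"
    by (simp add: power_mult power_mult_distrib[symmetric] power4_eq_xxxx)
  moreover have "(81 / 128 :: real) ^ n \<le> (81 / 128) ^ 1"
    by (rule power_decreasing) (use n in auto)
  ultimately have c: "1 / 3 \<le> ?c" by simp
  have "\<kappa> * ennreal (1 / 6) = \<kappa> / 2 * ennreal (1 / 3)"
    unfolding half_ennreal mult.assoc by (subst ennreal_mult[symmetric]) auto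
  also have "\<dots> \<le> \<kappa> / 2 * ennreal ((?c + ?c) / 2)"
    by (intro mult_left_mono ennreal_leI) (use c in auto)
  also have "\<dots> \<le> (op_u A ?g q + op_v A ?g p) / 2"
    by (intro half_sum_ennreal_ge)
      (use lazy_lower_bound[OF m u v, of n 0 "4 * n"] in auto)
  also have "\<dots> = (?T ^^ (4 * n + 2)) f x"
    unfolding x T[symmetric] by (simp add: funpow_swap1)
  finally show ?thesis .
qed

section \<open>Stationarity of the diagonal distribution\<close>

lemma nn_integral_diag_dist:
  assumes [measurable]: "f \<in> borel_measurable borel"
  shows "(\<integral>\<^sup>+x. f x \<partial>diag_dist A) =
     (\<integral>\<^sup>+v. indicator {0..1} v * (\<integral>\<^sup>+u. ennreal (indicator {0..1} u * gauss_weight A (u - v)) * f (u, v) \<partial>lborel) \<partial>lborel) /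
     (\<integral>\<^sup>+y. ennreal (case y of (u, v) \<Rightarrow> indicator unit_square (u, v) * gauss_weight A (u - v)) \<partial>lborel)"
proof -
  have [measurable]: "unit_square \<in> sets borel"
    by (simp add: borel_prod[symmetric])
  have [measurable]: "f \<in> borel_measurable (borel \<Otimes>\<^sub>M borel)"
    using assms by (simp add: borel_prod)
  let ?w = "\<lambda>y. ennreal (case y of (u, v) \<Rightarrow> indicator unit_square (u, v) * gauss_weight A (u - v))"
  let ?Z = "\<integral>\<^sup>+y. ?w y \<partial>lborel"
  have "(\<integral>\<^sup>+x. f x \<partial>diag_dist A) = (\<integral>\<^sup>+y. ?w y / ?Z * f y \<partial>lborel)"
    unfolding diag_dist_def prop_density_def
    by (subst nn_integral_density) (auto simp: case_prod_beta)
  also have "\<dots> = (\<integral>\<^sup>+y. ?w y * f y / ?Z \<partial>lborel)"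
    by (simp add: divide_ennreal_def mult_ac)
  also have "\<dots> = (\<integral>\<^sup>+y. ?w y * f y \<partial>lborel) / ?Z"
    by (rule nn_integral_divide) (auto simp: case_prod_beta)
  also have "(\<integral>\<^sup>+y. ?w y * f y \<partial>lborel) = (\<integral>\<^sup>+v. (\<integral>\<^sup>+u. ?w (u, v) * f (u, v) \<partial>lborel) \<partial>lborel)"
    unfolding lborel_prod[symmetric]
    by (subst lborel_pair.nn_integral_snd[symmetric])
      (auto simp: case_prod_beta borel_prod)
  also have "\<dots> = (\<integral>\<^sup>+v. indicator {0..1} v * (\<integral>\<^sup>+u. ennreal (indicator {0..1} u * gauss_weight A (u - v)) * f (u, v) \<partial>lborel) \<partial>lborel)"
  proof (intro nn_integral_cong, goal_cases)
    case (1 v)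
    show ?case
      by (subst nn_integral_cmult[symmetric])
         (auto intro!: nn_integral_cong split: split_indicator)
  qed
  finally show ?thesis .
qed

text \<open>For fixed v, the unnormalized weight has total mass \<open>cond_mass A v\<close> in u,
  exactly the factor by which \<open>op_u\<close> divides.\<close>

lemma nn_integral_diag_dist_op_u:
  assumes [measurable]: "f \<in> borel_measurable borel"
  shows "(\<integral>\<^sup>+x. op_u A f (snd x) \<partial>diag_dist A) = (\<integral>\<^sup>+x. f x \<partial>diag_dist A)"
proof -
  have [measurable]: "f \<in> borel_measurable (borel \<Otimes>\<^sub>M borel)"
    using assms by (simp add: borel_prod)
  have "(\<integral>\<^sup>+u. ennreal (indicator {0..1} u * gauss_weight A (u - v)) * op_u A f v \<partial>lborel) =
      (\<integral>\<^sup>+u. ennreal (indicator {0..1} u * gauss_weight A (u - v)) * f (u, v) \<partial>lborel)" for v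
  proof -
    have "(\<integral>\<^sup>+u. ennreal (indicator {0..1} u * gauss_weight A (u - v)) * op_u A f v \<partial>lborel) =
        cond_mass A v * op_u A f v"
      unfolding cond_mass_def by (rule nn_integral_multc) measurable
    also have "\<dots> = (\<integral>\<^sup>+u. ennreal (indicator {0..1} u * gauss_weight A (u - v)) * f (u, v) \<partial>lborel)"
      unfolding op_u_def kernel_op_def
      using cond_mass_finite[of A v]
      by (subst nn_integral_cond_u)
        (auto simp: ennreal_times_divide mult_divide_eq_ennreal mult.commute[of "cond_mass A v"])
    finally show ?thesis .
  qed
  then show ?thesis by (simp add: nn_integral_diag_dist)
qed

text \<open>Since \<open>gauss_weight\<close> is even, the two coordinates are exchangeable; this
  turns the invariance under u-updates into that under v-updates.\<close>

lemma nn_integral_diag_dist_swap: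
  assumes [measurable]: "f \<in> borel_measurable borel"
  shows "(\<integral>\<^sup>+x. f (snd x, fst x) \<partial>diag_dist A) = (\<integral>\<^sup>+x. f x \<partial>diag_dist A)"
proof -
  have [measurable]: "f \<in> borel_measurable (borel \<Otimes>\<^sub>M borel)"
    using assms by (simp add: borel_prod)
  have m: "(\<lambda>x. f (snd x, fst x)) \<in> borel_measurable borel"
    unfolding borel_prod[symmetric] by measurable
  have w: "gauss_weight A (u - v) = gauss_weight A (v - u)" for u v
    using gauss_weight_minus[of A "v - u"] by simp
  let ?h = "\<lambda>u v. indicator {0..1} v * (ennreal (indicator {0..1} u * gauss_weight A (u - v)) * f (v, u))"
  have "(\<integral>\<^sup>+v. indicator {0..1} v * (\<integral>\<^sup>+u. ennreal (indicator {0..1} u * gauss_weight A (u - v)) * f (v, u) \<partial>lborel) \<partial>lborel) =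
      (\<integral>\<^sup>+v. (\<integral>\<^sup>+u. ?h u v \<partial>lborel) \<partial>lborel)"
    by (intro nn_integral_cong nn_integral_cmult[symmetric]) auto
  also have "\<dots> = (\<integral>\<^sup>+u. (\<integral>\<^sup>+v. ?h u v \<partial>lborel) \<partial>lborel)"
    by (rule lborel_pair.Fubini'[symmetric]) measurable
  also have "\<dots> = (\<integral>\<^sup>+v. indicator {0..1} v * (\<integral>\<^sup>+u. ennreal (indicator {0..1} u * gauss_weight A (u - v)) * f (u, v) \<partial>lborel) \<partial>lborel)"
    by (subst nn_integral_cmult[symmetric])
      (auto intro!: nn_integral_cong split: split_indicator simp: w)
  finally show ?thesis
    using nn_integral_diag_dist[OF m] nn_integral_diag_dist[OF assms] by simp
qed

lemma nn_integral_diag_dist_op_v: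
  assumes [measurable]: "f \<in> borel_measurable borel"
  shows "(\<integral>\<^sup>+x. op_v A f (fst x) \<partial>diag_dist A) = (\<integral>\<^sup>+x. f x \<partial>diag_dist A)"
proof -
  have [measurable]: "f \<in> borel_measurable (borel \<Otimes>\<^sub>M borel)"
    using assms by (simp add: borel_prod)
  have m: "(\<lambda>x. f (snd x, fst x)) \<in> borel_measurable borel"
    unfolding borel_prod[symmetric] by measurable
  have "op_v A f = op_u A (\<lambda>x. f (snd x, fst x))"
    by (auto simp: op_u_def op_v_def)
  then have "(\<integral>\<^sup>+x. op_v A f (fst x) \<partial>diag_dist A) = (\<integral>\<^sup>+x. op_u A (\<lambda>x. f (snd x, fst x)) (snd x) \<partial>diag_dist A)"
    using nn_integral_diag_dist_swap[of "\<lambda>x. op_v A f (snd x)" A] by simp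
  then show ?thesis
    by (simp add: nn_integral_diag_dist_op_u[OF m] nn_integral_diag_dist_swap)
qed

lemma diag_dist_stationary:
  assumes [measurable]: "f \<in> borel_measurable borel"
  shows "(\<integral>\<^sup>+x. kernel_op (gibbs_kernel A) f x \<partial>diag_dist A) = (\<integral>\<^sup>+x. f x \<partial>diag_dist A)"
proof -
  have "(\<integral>\<^sup>+x. kernel_op (gibbs_kernel A) f x \<partial>diag_dist A) =
      (\<integral>\<^sup>+x. (op_u A f (snd x) + op_v A f (fst x)) / 2 \<partial>diag_dist A)"
    using kernel_op_gibbs[OF assms] by (intro nn_integral_cong) (metis prod.collapse)
  also have "\<dots> = ((\<integral>\<^sup>+x. op_u A f (snd x) \<partial>diag_dist A) + (\<integral>\<^sup>+x. op_v A f (fst x) \<partial>diag_dist A)) / 2"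
    by (simp add: nn_integral_divide nn_integral_add)
  also have "\<dots> = (\<integral>\<^sup>+x. f x \<partial>diag_dist A)"
    by (simp add: nn_integral_diag_dist_op_u nn_integral_diag_dist_op_v half_add_self_ennreal
        del: mult_2 mult_2_right)
  finally show ?thesis .
qed

subsection \<open>Minorization in the interior\<close>

text \<open>The n-step transition density of the free walk with Gaussian increments of variance
  \<open>1 / (2 * A\<^sup>2)\<close>, the law on the whole line with density proportional to
  \<open>gauss_weight A\<close>.\<close>

definition walk_density :: "real \<Rightarrow> nat \<Rightarrow> real \<Rightarrow> real" where
  "walk_density A n = normal_density 0 (sqrt (n / (2 * A\<^sup>2)))"

lemma walk_density_eq:
  assumes "0 < A" "0 < n"
  shows "walk_density A n s = A / sqrt (pi * n) * exp (- (A\<^sup>2 * s\<^sup>2 / n))"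
proof -
  have "2 * pi * (n / (2 * A\<^sup>2)) = (pi * n) / A\<^sup>2"
    by (simp add: field_simps)
  then have "1 / sqrt (2 * pi * (n / (2 * A\<^sup>2))) = A / sqrt (pi * n)"
    using assms by (simp add: real_sqrt_divide)
  moreover have "s\<^sup>2 / (2 * (n / (2 * A\<^sup>2))) = A\<^sup>2 * s\<^sup>2 / n"
    using assms by (simp add: field_simps)
  ultimately show ?thesis
    using assms by (simp add: walk_density_def normal_density_def)
qed

lemma walk_density_nonneg: "0 \<le> walk_density A n s"
  by (simp add: walk_density_def)

lemma walk_density_measurable [measurable]: "walk_density A n \<in> borel_measurable borel"
  by (simp add: walk_density_def)

lemma nn_integral_walk_density:
  assumes "0 < A" "0 < n"
  shows "(\<integral>\<^sup>+z. ennreal (walk_density A n (x - z)) \<partial>lborel) = 1"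
proof -
  have s: "0 < sqrt (n / (2 * A\<^sup>2))" using assms by simp
  have "(\<integral>\<^sup>+z. ennreal (walk_density A n (x - z)) \<partial>lborel) =
      (\<integral>\<^sup>+z. ennreal (normal_density x (sqrt (n / (2 * A\<^sup>2))) z) \<partial>lborel)"
    by (simp add: walk_density_def normal_density_def power2_commute)
  also have "\<dots> = 1"
    using prob_space.emeasure_space_1[OF prob_space_normal_density[OF s, of x]]
    by (simp add: emeasure_density)
  finally show ?thesis .
qed

lemma walk_density_conv:
  assumes "0 < A" "0 < m" "0 < n"
  shows "(\<integral>\<^sup>+z. ennreal (walk_density A m (x - z)) * ennreal (walk_density A n (z - y)) \<partial>lborel) =
    ennreal (walk_density A (m + n) (x - y))"
proof -
  have "(\<integral>\<^sup>+z. ennreal (walk_density A m (x - z)) * ennreal (walk_density A n (z - y)) \<partial>lborel) =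
      (\<integral>\<^sup>+z. ennreal (walk_density A m ((x - y) - z) * walk_density A n z) \<partial>lborel)"
    by (subst nn_integral_real_affine[where c=1 and t=y])
       (auto simp: ennreal_mult walk_density_nonneg algebra_simps)
  also have "\<dots> = ennreal (normal_density 0 (sqrt ((sqrt (m / (2 * A\<^sup>2)))\<^sup>2 + (sqrt (n / (2 * A\<^sup>2)))\<^sup>2)) (x - y))"
    unfolding walk_density_def
    using fun_cong[OF conv_normal_density_zero_mean[of "sqrt (m / (2 * A\<^sup>2))" "sqrt (n / (2 * A\<^sup>2))"], of "x - y"] assms
    by simp
  also have "(sqrt (m / (2 * A\<^sup>2)))\<^sup>2 + (sqrt (n / (2 * A\<^sup>2)))\<^sup>2 = real (m + n) / (2 * A\<^sup>2)"
    by (simp add: add_divide_distrib)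
  finally show ?thesis by (simp add: walk_density_def)
qed

lemma gauss_weight_eq_walk_density:
  assumes "0 < A"
  shows "gauss_weight A (y - x) = sqrt pi / A * walk_density A 1 (x - y)"
  using assms by (simp add: walk_density_eq gauss_weight_def power2_commute)

lemma cond_mass_le:
  assumes "0 < A"
  shows "cond_mass A x \<le> ennreal (sqrt pi / A)"
proof -
  have "cond_mass A x \<le> (\<integral>\<^sup>+y. ennreal (sqrt pi / A) * ennreal (walk_density A 1 (x - y)) \<partial>lborel)"
    unfolding cond_mass_def using assms
    by (intro nn_integral_mono)
      (auto simp: gauss_weight_eq_walk_density walk_density_nonneg ennreal_mult'[symmetric] split: split_indicator)
  also have "\<dots> = ennreal (sqrt pi / A)"
    using assms by (subst nn_integral_cmult) (auto simp: nn_integral_walk_density)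
  finally show ?thesis .
qed

text \<open>The normalizing constant \<open>cond_mass\<close> is at most the Gaussian integral
  \<open>sqrt pi / A\<close> over the whole line, so restricting to the unit interval can only
  increase the normalized density there.\<close>

lemma kernel_op_cond_u_ge:
  assumes A: "0 < A" and f [measurable]: "f \<in> borel_measurable borel"
  shows "(\<integral>\<^sup>+z. ennreal (walk_density A 1 (x - z)) * (f z * indicator {0..1} z) \<partial>lborel)
    \<le> kernel_op (cond_u A) f x"
proof -
  have "(\<integral>\<^sup>+y. ennreal (indicator {0..1} y * gauss_weight A (y - x)) * f y \<partial>lborel) =
      (\<integral>\<^sup>+z. ennreal (sqrt pi / A) * (ennreal (walk_density A 1 (x - z)) * (f z * indicator {0..1} z)) \<partial>lborel)"
    using A by (intro nn_integral_cong)
      (auto simp: gauss_weight_eq_walk_density walk_density_nonneg mult.assoc[symmetric] split: split_indicator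
        simp flip: ennreal_mult')
  also have "\<dots> = ennreal (sqrt pi / A) * (\<integral>\<^sup>+z. ennreal (walk_density A 1 (x - z)) * (f z * indicator {0..1} z) \<partial>lborel)"
    (is "_ = _ * ?R")
    by (rule nn_integral_cmult) measurable
  finally have e: "(\<integral>\<^sup>+y. ennreal (indicator {0..1} y * gauss_weight A (y - x)) * f y \<partial>lborel) =
      ennreal (sqrt pi / A) * ?R" .
  have "?R = ?R * cond_mass A x / cond_mass A x"
    using cond_mass_finite[of A x] by (simp add: mult_divide_eq_ennreal)
  also have "\<dots> \<le> ennreal (sqrt pi / A) * ?R / cond_mass A x"
    by (subst mult.commute) (intro divide_right_mono_ennreal mult_right_mono cond_mass_le A, simp)
  also have "\<dots> = kernel_op (cond_u A) f x"
    unfolding kernel_op_def nn_integral_cond_u[OF f] e ..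
  finally show ?thesis .
qed

text \<open>The constant \<open>M\<close> pays for the paths of the free Gaussian walk that leave the unit interval.\<close>

lemma killed_walk_lower_bound:
  assumes A: "0 < A" and n: "1 \<le> n" and f [measurable]: "f \<in> borel_measurable borel"
    and I [measurable]: "I \<in> sets borel" and I01: "I \<subseteq> {0..1}"
    and M: "\<And>m z y. 1 \<le> m \<Longrightarrow> m < n \<Longrightarrow> z \<notin> {0..1} \<Longrightarrow> y \<in> I \<Longrightarrow> ennreal (walk_density A m (z - y)) \<le> M"
  shows "(\<integral>\<^sup>+y. ennreal (walk_density A n (x - y)) * (f y * indicator I y) \<partial>lborel)
    \<le> (kernel_op (cond_u A) ^^ n) f x + M * (\<integral>\<^sup>+y. f y * indicator I y \<partial>lborel)"
  using n M
proof (induction n arbitrary: x rule: nat_induct_at_least)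
  case base
  have "(\<integral>\<^sup>+y. ennreal (walk_density A 1 (x - y)) * (f y * indicator I y) \<partial>lborel) \<le>
      (\<integral>\<^sup>+z. ennreal (walk_density A 1 (x - z)) * (f z * indicator {0..1} z) \<partial>lborel)"
    by (intro nn_integral_mono mult_left_mono) (use I01 in \<open>auto split: split_indicator\<close>)
  also have "\<dots> \<le> kernel_op (cond_u A) f x"
    by (rule kernel_op_cond_u_ge[OF A f])
  finally show ?case by (simp add: add_increasing2)
next
  case (Suc n)
  let ?F = "\<integral>\<^sup>+y. f y * indicator I y \<partial>lborel"
  let ?H = "\<lambda>z. \<integral>\<^sup>+y. ennreal (walk_density A n (z - y)) * (f y * indicator I y) \<partial>lborel"
  let ?g = "(kernel_op (cond_u A) ^^ n) f"
  have g [measurable]: "?g \<in> borel_measurable borel"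
    by (rule funpow_cond_u_measurable[OF f])
  \<comment> \<open>Here z is the position after the first step. Inside the unit interval the
    induction hypothesis applies; outside, the remaining n steps of the free walk are bounded by
    M.\<close>
  have H: "?H z \<le> ?g z * indicator {0..1} z + M * ?F" for z
  proof (cases "z \<in> {0..1}")
    case True
    then show ?thesis using Suc.IH[of z] Suc.prems by simp
  next
    case False
    have "?H z \<le> (\<integral>\<^sup>+y. M * (f y * indicator I y) \<partial>lborel)"
      by (intro nn_integral_mono) (use Suc.prems[of n z] Suc.hyps False in
        \<open>auto intro!: mult_right_mono split: split_indicator\<close>)
    also have "\<dots> = M * ?F" by (rule nn_integral_cmult) measurable
    finally show ?thesis using False by simp
  qed
  have "(\<integral>\<^sup>+y. ennreal (walk_density A (Suc n) (x - y)) * (f y * indicator I y) \<partial>lborel) =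
      (\<integral>\<^sup>+y. (\<integral>\<^sup>+z. ennreal (walk_density A 1 (x - z)) * ennreal (walk_density A n (z - y)) * (f y * indicator I y) \<partial>lborel) \<partial>lborel)"
    using walk_density_conv[OF A, of 1 n] Suc.hyps
    by (intro nn_integral_cong) (subst nn_integral_multc, auto)
  also have "\<dots> = (\<integral>\<^sup>+z. (\<integral>\<^sup>+y. ennreal (walk_density A 1 (x - z)) * ennreal (walk_density A n (z - y)) * (f y * indicator I y) \<partial>lborel) \<partial>lborel)"
    by (rule lborel_pair.Fubini') measurable
  also have "\<dots> = (\<integral>\<^sup>+z. ennreal (walk_density A 1 (x - z)) * ?H z \<partial>lborel)"
    by (intro nn_integral_cong) (subst nn_integral_cmult[symmetric], auto simp: mult.assoc)
  also have "\<dots> \<le> (\<integral>\<^sup>+z. ennreal (walk_density A 1 (x - z)) * (?g z * indicator {0..1} z + M * ?F) \<partial>lborel)"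
    by (intro nn_integral_mono mult_left_mono H) auto
  also have "\<dots> = (\<integral>\<^sup>+z. ennreal (walk_density A 1 (x - z)) * (?g z * indicator {0..1} z) \<partial>lborel) +
      (\<integral>\<^sup>+z. ennreal (walk_density A 1 (x - z)) * (M * ?F) \<partial>lborel)"
    unfolding distrib_left by (rule nn_integral_add) measurable
  \<comment> \<open>The one-step density integrates to 1, so the error term is reproduced unchanged
    and does not accumulate with the number of steps.\<close>
  also have "(\<integral>\<^sup>+z. ennreal (walk_density A 1 (x - z)) * (M * ?F) \<partial>lborel) = M * ?F"
    by (subst nn_integral_multc) (use nn_integral_walk_density[OF A, of 1 x] in auto)
  also have "(\<integral>\<^sup>+z. ennreal (walk_density A 1 (x - z)) * (?g z * indicator {0..1} z) \<partial>lborel) + M * ?F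
      \<le> (kernel_op (cond_u A) ^^ Suc n) f x + M * ?F"
    using kernel_op_cond_u_ge[OF A g, of x] by (auto intro: add_right_mono)
  finally show ?case .
qed

text \<open>The density decreases with the distance, and at fixed distance r it increases with time
  up to \<open>2 * r\<^sup>2 * A\<^sup>2\<close>, where the variance equals
  \<open>r\<^sup>2\<close>. So the worst case is distance r at the latest time n.\<close>

lemma walk_density_outside_le:
  assumes A: "0 < A" and m: "1 \<le> m" "m \<le> n" and r: "0 < r" "r \<le> \<bar>s\<bar>" "n \<le> 2 * r\<^sup>2 * A\<^sup>2"
  shows "walk_density A m s \<le> walk_density A n r"
proof -
  \<comment> \<open>Half the inverse variances: the densities are sqrt (q / pi) exp (- s^2 q), and
    likewise for p. The comparison reduces to q / p = 1 + (q - p) / p being at most exp (2 r^2 (q -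
    p)).\<close>
  define p q where "p = A\<^sup>2 / real n" and "q = A\<^sup>2 / real m"
  have p: "0 < p" "p \<le> q" using A m by (auto simp: p_def q_def frac_le)
  have pr: "1 \<le> 2 * r\<^sup>2 * p" using r m by (simp add: p_def field_simps)
  have sq: "A / sqrt (pi * k) = sqrt (A\<^sup>2 / k) / sqrt pi" if "0 < k" for k :: nat
    using A by (simp add: real_sqrt_divide real_sqrt_mult)
  have "q / p = 1 + (q - p) / p" using p by (simp add: field_simps)
  also have "\<dots> \<le> 1 + 2 * r\<^sup>2 * (q - p)"
  proof -
    have "(q - p) * 1 \<le> (q - p) * (2 * r\<^sup>2 * p)"
      using pr p by (intro mult_left_mono) auto
    then show ?thesis using p by (simp add: field_simps)
  qed
  also have "\<dots> \<le> exp (2 * r\<^sup>2 * (q - p))" by (rule exp_ge_add_one_self)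
  finally have "q \<le> p * exp (2 * (r\<^sup>2 * (q - p)))"
    using p by (simp add: field_simps)
  then have "sqrt q \<le> sqrt (p * exp (2 * (r\<^sup>2 * (q - p))))" by simp
  also have "\<dots> = sqrt p * exp (r\<^sup>2 * (q - p))"
    by (simp add: real_sqrt_mult exp_double)
  finally have "sqrt q * exp (- (r\<^sup>2 * q)) \<le> sqrt p * exp (r\<^sup>2 * (q - p)) * exp (- (r\<^sup>2 * q))"
    by (intro mult_right_mono) auto
  also have "\<dots> = sqrt p * exp (- (r\<^sup>2 * p))"
    by (simp add: mult.assoc exp_add[symmetric] algebra_simps)
  finally have 1: "sqrt q * exp (- (r\<^sup>2 * q)) \<le> sqrt p * exp (- (r\<^sup>2 * p))" .
  have "r\<^sup>2 \<le> s\<^sup>2" using r by (simp add: abs_le_square_iff[symmetric])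
  then have "r\<^sup>2 * q \<le> s\<^sup>2 * q" using p by (intro mult_right_mono) auto
  then have "exp (- (s\<^sup>2 * q)) \<le> exp (- (r\<^sup>2 * q))" by simp
  then have "sqrt q * exp (- (s\<^sup>2 * q)) \<le> sqrt q * exp (- (r\<^sup>2 * q))"
    by (rule mult_left_mono) (use p in auto)
  with 1 have "sqrt q * exp (- (s\<^sup>2 * q)) \<le> sqrt p * exp (- (r\<^sup>2 * p))" by linarith
  then have "sqrt q * exp (- (s\<^sup>2 * q)) / sqrt pi \<le> sqrt p * exp (- (r\<^sup>2 * p)) / sqrt pi"
    by (rule divide_right_mono) simp
  then show ?thesis
    using A m by (simp add: walk_density_eq sq p_def q_def mult.commute)
qed

text \<open>A start in [a, 1 - a] is within 1/2 - 3a/4 of every target within a/4 of 1/2, whereas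
  points outside the unit interval are at least 1/2 - a/4 away from the target. At n about A^2/4 the
  variance is of order 1, so the two distances give densities that differ by an amount independent
  of A.\<close>

lemma walk_density_gap:
  fixes a :: real
  assumes A: "2 \<le> A" and a: "0 < a" "a \<le> 1 / 2" and n: "n = nat \<lfloor>A\<^sup>2 / 4\<rfloor>"
    and s: "\<bar>s\<bar> \<le> 1 / 2 - 3 * a / 4"
  shows "walk_density A n (1 / 2 - a / 4) + a * exp (- 2) \<le> walk_density A n s"
proof -
  have A4: "1 \<le> A\<^sup>2 / 4" using power_mono[OF A, of 2] by simp
  have n1: "1 \<le> n" using A4 unfolding n by linarith
  have nr: "real n = of_int \<lfloor>A\<^sup>2 / 4\<rfloor>" using A4 unfolding n by simp
  have "1 \<le> \<lfloor>A\<^sup>2 / 4\<rfloor>" using A4 by (simp add: le_floor_iff)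
  then have nu: "real n \<le> A\<^sup>2 / 4" "A\<^sup>2 / 4 \<le> 2 * real n"
    using of_int_floor_le[of "A\<^sup>2 / 4"] real_of_int_floor_add_one_gt[of "A\<^sup>2 / 4"]
    unfolding nr by linarith+
  define p where "p = A\<^sup>2 / real n"
  \<comment> \<open>The lower bound makes the prefactor at least 1 and turns the gap a/4 between the
    squared distances into a gap a between the exponents. The upper bound, where rounding down costs
    a factor 2, keeps the exponent at most 2, whence \<open>exp (- 2)\<close>.\<close>
  have p: "4 \<le> p" "p \<le> 8" using nu n1 by (auto simp: p_def field_simps)
  have w: "walk_density A n r = sqrt (p / pi) * exp (- (r\<^sup>2 * p))" for r
    using A n1 by (simp add: walk_density_eq p_def real_sqrt_divide real_sqrt_mult mult.commute)
  have pp: "1 \<le> sqrt (p / pi)"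
    using p pi_less_4 by (simp add: field_simps)
  let ?b = "(1 / 2 - a / 4)\<^sup>2 * p"
  have "s\<^sup>2 \<le> (1 / 2 - 3 * a / 4)\<^sup>2"
    using s a by (simp add: abs_le_square_iff[symmetric])
  also have "\<dots> = (1 / 2 - a / 4)\<^sup>2 - a / 2 * (1 - a)"
    by (simp add: power2_eq_square field_simps)
  also have "\<dots> \<le> (1 / 2 - a / 4)\<^sup>2 - a / 4"
    using a by (simp add: field_simps mult_left_mono)
  finally have "s\<^sup>2 * p \<le> ((1 / 2 - a / 4)\<^sup>2 - a / 4) * p"
    using p by (intro mult_right_mono) auto
  also have "\<dots> \<le> ?b - a"
    using a p by (simp add: left_diff_distrib field_simps)
  finally have "exp (- ?b + a) \<le> exp (- (s\<^sup>2 * p))" by simp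
  moreover have "exp (- ?b) + a * exp (- ?b) \<le> exp (- ?b + a)"
    unfolding exp_add
    using mult_left_mono[OF exp_ge_add_one_self[of a], of "exp (- ?b)"] by (simp add: algebra_simps)
  ultimately have 1: "exp (- ?b) + a * exp (- ?b) \<le> exp (- (s\<^sup>2 * p))"
    by linarith
  have "(1 / 2 - a / 4)\<^sup>2 \<le> (1 / 2)\<^sup>2"
    by (rule power_mono) (use a in auto)
  then have "?b \<le> 1 / 4 * 8"
    using p by (intro mult_mono) (auto simp: power2_eq_square)
  then have "a * exp (- 2) \<le> a * exp (- ?b)" using a by simp
  also have "\<dots> \<le> sqrt (p / pi) * (a * exp (- ?b))"
    using mult_right_mono[OF pp, of "a * exp (- ?b)"] a by simp
  finally have "sqrt (p / pi) * exp (- ?b) + a * exp (- 2) \<le> sqrt (p / pi) * (exp (- ?b) + a * exp (- ?b))"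
    by (simp add: algebra_simps)
  also have "\<dots> \<le> sqrt (p / pi) * exp (- (s\<^sup>2 * p))"
    using 1 p by (intro mult_left_mono) auto
  finally show ?thesis unfolding w .
qed

text \<open>With r = 1/2 - a/4, the density at distance r and time n serves as the exit bound M, and
  \<open>walk_density_gap\<close> is the surplus over it. The time A^2/4 is early enough for
  \<open>walk_density_outside_le\<close>, because r is at least 3/8 and so 2 r^2 is at least
  1/4.\<close>

lemma cond_u_interior_minorization:
  fixes a :: real
  assumes A: "2 \<le> A" and a: "0 < a" "a \<le> 1 / 2" and x: "x \<in> {a..1 - a}"
    and f: "f \<in> borel_measurable borel"
  defines "n \<equiv> nat \<lfloor>A\<^sup>2 / 4\<rfloor>" and "I \<equiv> {1 / 2 - a / 4..1 / 2 + a / 4}"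
  shows "ennreal (a * exp (- 2)) * (\<integral>\<^sup>+y. f y * indicator I y \<partial>lborel) \<le> (kernel_op (cond_u A) ^^ n) f x"
proof -
  have A4: "1 \<le> A\<^sup>2 / 4" using power_mono[OF A, of 2] by simp
  have n1: "1 \<le> n" using A4 unfolding n_def by linarith
  have nA: "real n \<le> A\<^sup>2 / 4"
    using A4 of_int_floor_le[of "A\<^sup>2 / 4"] unfolding n_def by (simp del: of_int_floor_le)
  have Im [measurable]: "I \<in> sets borel" by (simp add: I_def)
  have I01: "I \<subseteq> {0..1}" using a by (auto simp: I_def)
  let ?r = "1 / 2 - a / 4"
  define M where "M = walk_density A n ?r"
  have M0: "0 \<le> M" by (simp add: M_def walk_density_nonneg)
  have r2: "1 / 8 \<le> ?r\<^sup>2"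
    using power_mono[of "3/8" ?r 2] a by (simp add: power2_eq_square)
  have "1 / 4 * A\<^sup>2 \<le> 2 * ?r\<^sup>2 * A\<^sup>2" using r2 by (intro mult_right_mono) auto
  then have nr: "real n \<le> 2 * ?r\<^sup>2 * A\<^sup>2" using nA by simp
  have out: "ennreal (walk_density A m (z - y)) \<le> ennreal M"
    if "1 \<le> m" "m < n" "z \<notin> {0..1}" "y \<in> I" for m z y
  proof -
    have "?r \<le> \<bar>z - y\<bar>" using that a by (auto simp: I_def)
    then show ?thesis
      unfolding M_def using that A a nr by (intro ennreal_leI walk_density_outside_le) auto
  qed
  \<comment> \<open>The exit term has to be cancelled from both sides, so it must be finite. Bounded
    functions are treated here; truncation and monotone convergence give the rest.\<close>
  have bounded: "ennreal (a * exp (- 2)) * (\<integral>\<^sup>+y. g y * indicator I y \<partial>lborel) \<le> (kernel_op (cond_u A) ^^ n) g x"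
    if g [measurable]: "g \<in> borel_measurable borel" and B: "\<And>y. g y \<le> ennreal B" for g B
  proof -
    let ?F = "\<integral>\<^sup>+y. g y * indicator I y \<partial>lborel"
    have "?F \<le> (\<integral>\<^sup>+y. ennreal B * indicator I y \<partial>lborel)"
      by (intro nn_integral_mono mult_right_mono B) auto
    also have "\<dots> = ennreal B * emeasure lborel I"
      by (rule nn_integral_cmult_indicator) simp
    also have "\<dots> < \<top>"
      by (simp add: I_def emeasure_lborel_Icc_eq ennreal_mult_less_top)
    finally have "?F < \<top>" .
    then have fin: "ennreal M * ?F \<noteq> \<top>" by (auto simp: ennreal_mult_eq_top_iff)
    have "ennreal (a * exp (- 2)) * ?F + ennreal M * ?F = (\<integral>\<^sup>+y. ennreal (M + a * exp (- 2)) * (g y * indicator I y) \<partial>lborel)"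
      using a M0 by (subst nn_integral_cmult) (auto simp: ennreal_plus distrib_right add.commute)
    also have "\<dots> \<le> (\<integral>\<^sup>+y. ennreal (walk_density A n (x - y)) * (g y * indicator I y) \<partial>lborel)"
    proof (intro nn_integral_mono)
      fix y
      show "ennreal (M + a * exp (- 2)) * (g y * indicator I y) \<le> ennreal (walk_density A n (x - y)) * (g y * indicator I y)"
      proof (cases "y \<in> I")
        case True
        then have "\<bar>x - y\<bar> \<le> 1 / 2 - 3 * a / 4" using x by (auto simp: I_def abs_le_iff)
        from walk_density_gap[OF A a n_def[THEN meta_eq_to_obj_eq] this]
        show ?thesis by (intro mult_right_mono ennreal_leI) (auto simp: M_def)
      qed simp
    qed
    also have "\<dots> \<le> (kernel_op (cond_u A) ^^ n) g x + ennreal M * ?F"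
      by (rule killed_walk_lower_bound[OF _ n1 g Im I01 out]) (use A in auto)
    finally show ?thesis using fin by (simp add: add.commute[of _ "ennreal M * ?F"] ennreal_add_left_cancel_le)
  qed
  have "(\<integral>\<^sup>+y. f y * indicator I y \<partial>lborel) = (\<integral>\<^sup>+y. (SUP k. min (f y) (ennreal (real k)) * indicator I y) \<partial>lborel)"
  proof (intro nn_integral_cong)
    fix y
    have "f y = (SUP k. min (f y) (ennreal (real k)))"
      by (subst inf_min[symmetric], subst inf_SUP[symmetric])
        (simp add: ennreal_SUP_of_nat_eq_top ennreal_of_nat_eq_real_of_nat[symmetric])
    then show "f y * indicator I y = (SUP k. min (f y) (ennreal (real k)) * indicator I y)"
      by (simp split: split_indicator)
  qed
  also have "\<dots> = (SUP k. \<integral>\<^sup>+y. min (f y) (ennreal (real k)) * indicator I y \<partial>lborel)"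
    using f by (intro nn_integral_monotone_convergence_SUP)
      (auto simp: incseq_def le_fun_def intro!: mult_right_mono min.mono ennreal_leI)
  finally have "ennreal (a * exp (- 2)) * (\<integral>\<^sup>+y. f y * indicator I y \<partial>lborel) =
      (SUP k. ennreal (a * exp (- 2)) * (\<integral>\<^sup>+y. min (f y) (ennreal (real k)) * indicator I y \<partial>lborel))"
    by (simp add: SUP_mult_left_ennreal)
  also have "\<dots> \<le> (kernel_op (cond_u A) ^^ n) f x"
  proof (rule SUP_least)
    fix k :: nat
    have "ennreal (a * exp (- 2)) * (\<integral>\<^sup>+y. min (f y) (ennreal (real k)) * indicator I y \<partial>lborel)
        \<le> (kernel_op (cond_u A) ^^ n) (\<lambda>y. min (f y) (ennreal (real k))) x"
      by (rule bounded[of _ "real k"]) (use f in auto)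
    also have "\<dots> \<le> (kernel_op (cond_u A) ^^ n) f x"
      by (rule kernel_op_cond_u_funpow_mono) (use x a in auto)
    finally show "ennreal (a * exp (- 2)) * (\<integral>\<^sup>+y. min (f y) (ennreal (real k)) * indicator I y \<partial>lborel)
        \<le> (kernel_op (cond_u A) ^^ n) f x" .
  qed
  finally show ?thesis .
qed

subsection \<open>Escape from the boundary\<close>

lemma gauss_weight_deriv:
  "((\<lambda>y. gauss_weight A (y - x)) has_real_derivative (- 2 * A\<^sup>2 * (y - x) * gauss_weight A (y - x))) (at y within S)"
  unfolding gauss_weight_def
  by (auto intro!: derivative_eq_intros)

lemma gauss_weight_continuous: "continuous_on S (\<lambda>y. gauss_weight A (y - x))"
  unfolding gauss_weight_def by (intro continuous_intros)

section \<open>Moments of the Gaussian weight on the unit interval and the one-step drift\<close>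

context
  fixes A x :: real
  assumes A: "20 \<le> A" and x: "x \<in> {0..1}"
begin

private abbreviation "w y \<equiv> gauss_weight A (y - x)"
private abbreviation "mom k \<equiv> integral {0..1} (\<lambda>y. (y - x) ^ k * w y)"

private lemma moment_integrable: "(\<lambda>y. (y - x) ^ k * w y) integrable_on {0..1}"
  by (intro integrable_continuous_real continuous_intros gauss_weight_continuous)

text \<open>Integration by parts, from the derivative of \<open>(y - x) ^ (k + 1) * w y\<close>. For
  even k the boundary terms only lower the moment, which yields the upper bounds on
  \<open>mom 2\<close> and \<open>mom 4\<close>.\<close>

private lemma moment_rec:
  "mom (k + 2) = (of_nat (k + 1) * mom k - ((1 - x) ^ (k + 1) * w 1 - (- x) ^ (k + 1) * w 0)) / (2 * A\<^sup>2)"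
proof -
  have "((\<lambda>y. of_nat (k + 1) * ((y - x) ^ k * w y) - 2 * A\<^sup>2 * ((y - x) ^ (k + 2) * w y)) has_integral
      ((1 - x) ^ (k + 1) * w 1 - (0 - x) ^ (k + 1) * w 0)) {0..1}"
  proof (rule fundamental_theorem_of_calculus)
    fix y
    have "((\<lambda>y. (y - x) ^ Suc k) has_real_derivative (1 + of_nat k) * (1 * (y - x) ^ k)) (at y within {0..1})"
      by (rule DERIV_power_Suc) (auto intro!: derivative_eq_intros)
    from DERIV_mult[OF this gauss_weight_deriv[of A x y]]
    show "((\<lambda>y. (y - x) ^ (k + 1) * w y) has_vector_derivative
        of_nat (k + 1) * ((y - x) ^ k * w y) - 2 * A\<^sup>2 * ((y - x) ^ (k + 2) * w y)) (at y within {0..1})"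
      unfolding has_real_derivative_iff_has_vector_derivative[symmetric]
      by (simp add: algebra_simps)
  qed simp
  moreover have "((\<lambda>y. of_nat (k + 1) * ((y - x) ^ k * w y) - 2 * A\<^sup>2 * ((y - x) ^ (k + 2) * w y)) has_integral
      (of_nat (k + 1) * mom k - 2 * A\<^sup>2 * mom (k + 2))) {0..1}"
    by (intro has_integral_diff has_integral_mult_right integrable_integral moment_integrable)
  ultimately have "of_nat (k + 1) * mom k - 2 * A\<^sup>2 * mom (k + 2) =
      (1 - x) ^ (k + 1) * w 1 - (0 - x) ^ (k + 1) * w 0"
    by (rule has_integral_unique[OF _ _, rotated])
  then show ?thesis using A by (simp add: field_simps)
qed

private lemma moment_1: "mom 1 = (w 0 - w 1) / (2 * A\<^sup>2)"
proof -
  have "((\<lambda>y. (y - x) ^ 1 * w y) has_integral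
      (- (w 1) / (2 * A\<^sup>2) - (- (w 0) / (2 * A\<^sup>2)))) {0..1}"
  proof (rule fundamental_theorem_of_calculus)
    fix y
    show "((\<lambda>y. - (w y) / (2 * A\<^sup>2)) has_vector_derivative (y - x) ^ 1 * w y) (at y within {0..1})"
      unfolding has_real_derivative_iff_has_vector_derivative[symmetric]
      using DERIV_cdivide[OF DERIV_minus[OF gauss_weight_deriv[of A x y "{0..1}"]], of "2 * A\<^sup>2"] A
      by simp
  qed simp
  then show ?thesis using A by (simp add: integral_unique field_simps)
qed

text \<open>The mean displacement points towards 1/2, since the weight is larger at the end point
  nearer to x. Only this sign enters the drift estimate, never the magnitude.\<close>

private lemma drift_nonneg: "0 \<le> (1 - 2 * x) * mom 1"
proof -
  have "x \<le> 1 / 2 \<Longrightarrow> w 1 \<le> w 0"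
    using x power_mono[of x "1 - x" 2] by (auto simp: gauss_weight_def intro!: mult_left_mono)
  moreover have "1 / 2 \<le> x \<Longrightarrow> w 0 \<le> w 1"
    using x power_mono[of "1 - x" x 2] by (auto simp: gauss_weight_def intro!: mult_left_mono)
  ultimately have "0 \<le> (1 - 2 * x) * (w 0 - w 1)"
    by (cases "x \<le> 1 / 2") (intro mult_nonneg_nonneg mult_nonpos_nonpos; linarith)+
  then show ?thesis
    unfolding moment_1 times_divide_eq_right by (rule divide_nonneg_nonneg) simp
qed

private lemma moment_nonneg: "even k \<Longrightarrow> 0 \<le> mom k"
  by (intro integral_nonneg moment_integrable) (auto simp: gauss_weight_def zero_le_even_power)

private lemma moment_2_le: "mom 2 \<le> mom 0 / (2 * A\<^sup>2)"
proof -
  have "0 \<le> (1 - x) * w 1 + x * w 0"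
    using x by (auto intro!: add_nonneg_nonneg mult_nonneg_nonneg simp: gauss_weight_def)
  then show ?thesis
    using moment_rec[of 0] A by (simp add: numeral_2_eq_2[symmetric] divide_right_mono)
qed

private lemma moment_4_le: "mom 4 \<le> 3 * mom 2 / (2 * A\<^sup>2)"
proof -
  have "0 \<le> (1 - x) ^ 3 * w 1 + x ^ 3 * w 0"
    using x by (auto intro!: add_nonneg_nonneg mult_nonneg_nonneg simp: gauss_weight_def)
  then show ?thesis
    using moment_rec[of 2] A by (simp add: divide_right_mono)
qed

private lemma cond_mass_eq: "cond_mass A x = ennreal (mom 0)"
proof -
  have "((\<lambda>y. (y - x) ^ 0 * w y) has_integral mom 0) {0..1}"
    by (rule integrable_integral[OF moment_integrable])
  then have "(w has_integral mom 0) {0..1}" by simp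
  then have "(\<integral>\<^sup>+y. ennreal (indicator {0..1} y * w y) \<partial>lborel) = ennreal (mom 0)"
    by (rule nn_integral_has_integral_lebesgue[rotated]) (simp add: gauss_weight_def)
  then show ?thesis by (simp add: cond_mass_def)
qed

private lemma moment_0_le: "mom 0 \<le> 2 / A"
proof -
  have "ennreal (mom 0) \<le> ennreal (sqrt pi / A)"
    using cond_mass_le[of A x] A by (simp add: cond_mass_eq)
  then have "mom 0 \<le> sqrt pi / A" using A by (simp add: ennreal_le_iff)
  also have "sqrt pi \<le> 2" using pi_less_4 by (intro real_le_lsqrt) auto
  then have "sqrt pi / A \<le> 2 / A" using A by (intro divide_right_mono) auto
  finally show ?thesis .
qed

text \<open>Keep only the displacements between 1/(2A) and 1/A on the side of x with more room.
  There the squared displacement is at least 1/(4 A^2) and the weight at least 1/e, hence 1/3, on a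
  length 1/(2A). The result 1/(24 A^3) is compared with \<open>moment_0_le\<close>.\<close>

private lemma moment_2_ge: "mom 0 / (48 * A\<^sup>2) \<le> mom 2"
proof -
  define d where "d = 1 / A"
  have d: "0 < d" "d \<le> 1 / 20" using A by (auto simp: d_def intro!: divide_left_mono)
  have d2: "1 / (2 * A) = d / 2" by (simp add: d_def)
  define lo where "lo = (if x \<le> 1 / 2 then x + d / 2 else x - d)"
  have lo: "{lo..lo + d / 2} \<subseteq> {0..1}"
    using d x by (auto simp: lo_def)
  have e: "1 / 3 \<le> exp (- 1 :: real)"
    using exp_le by (simp add: exp_minus field_simps)
  have pt: "1 / (12 * A\<^sup>2) \<le> (y - x) ^ 2 * w y" if "y \<in> {lo..lo + d / 2}" for y
  proof -
    have "d / 2 \<le> \<bar>y - x\<bar>" "\<bar>y - x\<bar> \<le> d"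
      using that d by (auto simp: lo_def split: if_splits)
    then have d: "1 / (2 * A) \<le> \<bar>y - x\<bar>" "\<bar>y - x\<bar> \<le> 1 / A"
      by (simp_all add: d2 d_def)
    have "(1 / (2 * A))\<^sup>2 \<le> \<bar>y - x\<bar>\<^sup>2" using A by (intro power_mono d) auto
    then have 1: "1 / (4 * A\<^sup>2) \<le> (y - x)\<^sup>2" by (simp add: power_divide power_mult_distrib)
    have "\<bar>y - x\<bar>\<^sup>2 \<le> (1 / A)\<^sup>2" by (intro power_mono d) auto
    then have "A\<^sup>2 * (y - x)\<^sup>2 \<le> 1" using A by (simp add: field_simps)
    then have "exp (- 1) \<le> w y" by (simp add: gauss_weight_def)
    with e have 2: "1 / 3 \<le> w y" by linarith
    have "1 / (12 * A\<^sup>2) = 1 / (4 * A\<^sup>2) * (1 / 3)" by simp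
    also have "\<dots> \<le> (y - x)\<^sup>2 * w y" by (intro mult_mono 1 2) auto
    finally show ?thesis .
  qed
  have i: "(\<lambda>y. (y - x) ^ 2 * w y) integrable_on {lo..lo + d / 2}"
    by (intro integrable_continuous_real continuous_intros gauss_weight_continuous)
  have "1 / (24 * A ^ 3) = integral {lo..lo + d / 2} (\<lambda>y. 1 / (12 * A\<^sup>2))"
    using A d by (simp add: d_def power2_eq_square power3_eq_cube)
  also have "\<dots> \<le> integral {lo..lo + d / 2} (\<lambda>y. (y - x) ^ 2 * w y)"
    by (rule integral_le) (use i pt in auto)
  also have "\<dots> \<le> mom 2"
    by (rule integral_subset_le[OF lo i moment_integrable]) (auto simp: gauss_weight_def)
  finally have *: "1 / (24 * A ^ 3) \<le> mom 2" .
  have "mom 0 / (48 * A\<^sup>2) \<le> 2 / A / (48 * A\<^sup>2)"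
    using moment_0_le A by (intro divide_right_mono) auto
  also have "\<dots> = 1 / (24 * A ^ 3)" by (simp add: power2_eq_square power3_eq_cube)
  finally show ?thesis using * by simp
qed

text \<open>A second-order expansion of (y (1 - y))^2 about x, integrated against the weight. The
  linear term is nonnegative by \<open>drift_nonneg\<close>. The quadratic coefficient is positive
  near the end points, where h is small; elsewhere its negative part is charged to the loss factor
  in front of h^2.\<close>

private lemma quartic_drift:
  "((1 - 384 / A\<^sup>2) * (x * (1 - x))\<^sup>2 + 1 / (384 * A\<^sup>2)) * mom 0
    \<le> integral {0..1} (\<lambda>y. (y * (1 - y))\<^sup>2 * w y)"
proof -
  define h where "h = x * (1 - x)"
  have h: "0 \<le> h" using x by (simp add: h_def)
  \<comment> \<open>Half of the leading quadratic coefficient is spent on completing a square that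
    absorbs the cubic term, so no third moment appears; the price is the negative quartic
    term.\<close>
  have pt: "h\<^sup>2 + 2 * h * (1 - 2 * x) * (y - x) + (1 / 2 - 4 * h) * (y - x)\<^sup>2 - (y - x) ^ 4 \<le> (y * (1 - y))\<^sup>2" for y
  proof -
    have "(y * (1 - y))\<^sup>2 - (h\<^sup>2 + 2 * h * (1 - 2 * x) * (y - x) + (1 / 2 - 4 * h) * (y - x)\<^sup>2 - (y - x) ^ 4) =
        (y - x)\<^sup>2 * ((1 - 2 * x) - 2 * (y - x))\<^sup>2 / 2"
      unfolding h_def by (simp add: power2_eq_square power4_eq_xxxx field_simps)
    also have "\<dots> \<ge> 0" by simp
    finally show ?thesis by simp
  qed
  have "((\<lambda>y. h\<^sup>2 * ((y - x) ^ 0 * w y) + 2 * h * (1 - 2 * x) * ((y - x) ^ 1 * w y) +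
        (1 / 2 - 4 * h) * ((y - x) ^ 2 * w y) - (y - x) ^ 4 * w y) has_integral
      (h\<^sup>2 * mom 0 + 2 * h * (1 - 2 * x) * mom 1 + (1 / 2 - 4 * h) * mom 2 - mom 4)) {0..1}"
    by (intro has_integral_diff has_integral_add has_integral_mult_right integrable_integral moment_integrable)
  moreover have "((\<lambda>y. (y * (1 - y))\<^sup>2 * w y) has_integral integral {0..1} (\<lambda>y. (y * (1 - y))\<^sup>2 * w y)) {0..1}"
    by (intro integrable_integral integrable_continuous_real continuous_intros gauss_weight_continuous)
  ultimately have "h\<^sup>2 * mom 0 + 2 * h * (1 - 2 * x) * mom 1 + (1 / 2 - 4 * h) * mom 2 - mom 4
      \<le> integral {0..1} (\<lambda>y. (y * (1 - y))\<^sup>2 * w y)"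
  proof (rule has_integral_le)
    fix y
    have "(h\<^sup>2 + 2 * h * (1 - 2 * x) * (y - x) + (1 / 2 - 4 * h) * (y - x)\<^sup>2 - (y - x) ^ 4) * w y
        \<le> (y * (1 - y))\<^sup>2 * w y"
      by (intro mult_right_mono pt) (simp add: gauss_weight_def)
    then show "h\<^sup>2 * ((y - x) ^ 0 * w y) + 2 * h * (1 - 2 * x) * ((y - x) ^ 1 * w y) +
        (1 / 2 - 4 * h) * ((y - x) ^ 2 * w y) - (y - x) ^ 4 * w y \<le> (y * (1 - y))\<^sup>2 * w y"
      by (simp add: algebra_simps)
  qed
  moreover have "0 \<le> 2 * h * ((1 - 2 * x) * mom 1)"
    using h drift_nonneg by simp
  ultimately have 1: "h\<^sup>2 * mom 0 + (1 / 2 - 4 * h) * mom 2 - mom 4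
      \<le> integral {0..1} (\<lambda>y. (y * (1 - y))\<^sup>2 * w y)"
    by (simp add: mult.assoc)
  have A2: "400 \<le> A\<^sup>2" using power_mono[OF A, of 2] by simp
  have m0: "0 \<le> mom 0" and m2: "0 \<le> mom 2" by (rule moment_nonneg; simp)+
  \<comment> \<open>The quartic term costs at most half of the quadratic gain
    \<open>mom 2 / 2\<close>, so a quarter of \<open>mom 2\<close> remains.\<close>
  have "3 * mom 2 / (2 * A\<^sup>2) \<le> 1 / 4 * mom 2"
  proof -
    have "3 / (2 * A\<^sup>2) \<le> 3 / 12" using A2 by (intro divide_left_mono) auto
    then have "3 / (2 * A\<^sup>2) \<le> 1 / 4" by simp
    from mult_right_mono[OF this m2] show ?thesis by simp
  qed
  then have 2: "1 / 4 * mom 2 - 4 * h * mom 2 \<le> (1 / 2 - 4 * h) * mom 2 - mom 4"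
    using moment_4_le by (simp add: algebra_simps)
  have 3: "mom 0 / (192 * A\<^sup>2) \<le> 1 / 4 * mom 2" using moment_2_ge by simp
  have "h * mom 2 \<le> h * (mom 0 / (2 * A\<^sup>2))"
    by (rule mult_left_mono[OF moment_2_le h])
  also have "\<dots> = h * (mom 0 / A\<^sup>2) / 2" by simp
  finally have *: "h * mom 2 \<le> h * (mom 0 / A\<^sup>2) / 2" .
  have "4 * s \<le> 2 * t" if "s \<le> t / 2" for s t :: real using that by simp
  from this[OF *] have 4: "4 * h * mom 2 \<le> 2 * h * (mom 0 / A\<^sup>2)"
    by (simp only: mult.assoc)
  \<comment> \<open>The remaining gain is 1/192 in units of \<open>mom 0 / A\<^sup>2\<close>. The
    weight 384 in this arithmetic-geometric mean bound makes its constant term 1/384, half of that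
    gain; the other half is the additive term of the drift.\<close>
  have "0 \<le> 384 * (h - 1 / 384)\<^sup>2" by simp
  then have "2 * h \<le> 384 * h\<^sup>2 + 1 / 384" by (simp add: power2_eq_square algebra_simps)
  then have "2 * h * (mom 0 / A\<^sup>2) \<le> (384 * h\<^sup>2 + 1 / 384) * (mom 0 / A\<^sup>2)"
    by (rule mult_right_mono) (use m0 in auto)
  moreover have "((1 - 384 / A\<^sup>2) * h\<^sup>2 + 1 / (384 * A\<^sup>2)) * mom 0 =
      h\<^sup>2 * mom 0 + (mom 0 / (192 * A\<^sup>2) - (384 * h\<^sup>2 + 1 / 384) * (mom 0 / A\<^sup>2))"
    using A by (simp add: field_simps)
  ultimately have "((1 - 384 / A\<^sup>2) * h\<^sup>2 + 1 / (384 * A\<^sup>2)) * mom 0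
      \<le> h\<^sup>2 * mom 0 + (mom 0 / (192 * A\<^sup>2) - 2 * h * (mom 0 / A\<^sup>2))"
    by linarith
  then show ?thesis unfolding h_def[symmetric] using 1 2 3 4 by linarith
qed

lemma cond_u_quartic_drift:
  "ennreal ((1 - 384 / A\<^sup>2) * (x * (1 - x))\<^sup>2 + 1 / (384 * A\<^sup>2))
    \<le> kernel_op (cond_u A) (\<lambda>y. ennreal ((y * (1 - y))\<^sup>2)) x"
proof -
  let ?I = "integral {0..1} (\<lambda>y. (y * (1 - y))\<^sup>2 * w y)"
  have "((\<lambda>y. (y * (1 - y))\<^sup>2 * w y) has_integral ?I) {0..1}"
    by (intro integrable_integral integrable_continuous_real continuous_intros gauss_weight_continuous)
  then have "(\<integral>\<^sup>+y. ennreal (indicator {0..1} y * ((y * (1 - y))\<^sup>2 * w y)) \<partial>lborel) = ennreal ?I"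
    by (rule nn_integral_has_integral_lebesgue[rotated]) (simp add: gauss_weight_def)
  also have "(\<integral>\<^sup>+y. ennreal (indicator {0..1} y * ((y * (1 - y))\<^sup>2 * w y)) \<partial>lborel) =
      (\<integral>\<^sup>+y. ennreal (indicator {0..1} y * w y) * ennreal ((y * (1 - y))\<^sup>2) \<partial>lborel)"
    by (intro nn_integral_cong) (auto simp: ennreal_mult'' mult_ac split: split_indicator)
  finally have "kernel_op (cond_u A) (\<lambda>y. ennreal ((y * (1 - y))\<^sup>2)) x = ennreal ?I / ennreal (mom 0)"
    unfolding kernel_op_def by (subst nn_integral_cond_u) (auto simp: cond_mass_eq)
  also have "ennreal (((1 - 384 / A\<^sup>2) * (x * (1 - x))\<^sup>2 + 1 / (384 * A\<^sup>2)) * mom 0) / ennreal (mom 0) \<le> \<dots>"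
    by (intro divide_right_mono_ennreal ennreal_leI quartic_drift)
  also have "ennreal (((1 - 384 / A\<^sup>2) * (x * (1 - x))\<^sup>2 + 1 / (384 * A\<^sup>2)) * mom 0) / ennreal (mom 0) =
      ennreal ((1 - 384 / A\<^sup>2) * (x * (1 - x))\<^sup>2 + 1 / (384 * A\<^sup>2))"
    using cond_mass_finite[of A x] unfolding cond_mass_eq ennreal_mult''[OF moment_nonneg[OF even_zero]]
    by (intro mult_divide_eq_ennreal) auto
  finally show ?thesis .
qed

end

text \<open>The drift bound is an affine map with slope 1 - 384/A^2 and fixed point 1/384^2, and
  this is its m-th iterate. The slope is nonnegative because 20^2 exceeds 384.\<close>

lemma funpow_cond_u_quartic:
  assumes A: "20 \<le> A" and x: "x \<in> {0..1}"
  shows "ennreal ((1 - 384 / A\<^sup>2) ^ m * (x * (1 - x))\<^sup>2 + (1 - (1 - 384 / A\<^sup>2) ^ m) / 384\<^sup>2)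
    \<le> (kernel_op (cond_u A) ^^ m) (\<lambda>y. ennreal ((y * (1 - y))\<^sup>2)) x"
  using x
proof (induction m arbitrary: x)
  case (Suc m)
  define \<rho> where "\<rho> = 1 - 384 / A\<^sup>2"
  have A2: "400 \<le> A\<^sup>2" using power_mono[OF A, of 2] by simp
  have "384 / A\<^sup>2 \<le> 1" using A A2 by (subst divide_le_eq_1_pos) auto
  then have \<rho>: "0 \<le> \<rho>" "\<rho> \<le> 1" by (auto simp: \<rho>_def)
  have \<rho>m: "0 \<le> \<rho> ^ m" "\<rho> ^ m \<le> 1" using \<rho> by (auto intro: power_le_one)
  let ?G = "\<lambda>y. ennreal ((y * (1 - y))\<^sup>2)"
  have s: "1 / (384 * A\<^sup>2) = (1 - \<rho>) / 384\<^sup>2" using A2 by (simp add: \<rho>_def power2_eq_square)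
  have drift: "ennreal (\<rho> * (x * (1 - x))\<^sup>2 + (1 - \<rho>) / 384\<^sup>2) \<le> kernel_op (cond_u A) ?G x"
    using cond_u_quartic_drift[OF A Suc.prems] unfolding s \<rho>_def[symmetric] .
  have "ennreal (\<rho> ^ Suc m * (x * (1 - x))\<^sup>2 + (1 - \<rho> ^ Suc m) / 384\<^sup>2) =
      ennreal (\<rho> ^ m * (\<rho> * (x * (1 - x))\<^sup>2 + (1 - \<rho>) / 384\<^sup>2) + (1 - \<rho> ^ m) / 384\<^sup>2)"
    by (rule arg_cong[where f=ennreal]) (simp add: algebra_simps diff_divide_distrib)
  also have "\<dots> = ennreal (\<rho> ^ m) * ennreal (\<rho> * (x * (1 - x))\<^sup>2 + (1 - \<rho>) / 384\<^sup>2) + ennreal ((1 - \<rho> ^ m) / 384\<^sup>2)"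
    using \<rho> \<rho>m by (simp add: ennreal_mult')
  also have "\<dots> \<le> ennreal (\<rho> ^ m) * kernel_op (cond_u A) ?G x + ennreal ((1 - \<rho> ^ m) / 384\<^sup>2)"
    by (intro add_right_mono mult_left_mono drift) simp
  also have "\<dots> = kernel_op (cond_u A) (\<lambda>y. ennreal (\<rho> ^ m) * ?G y + ennreal ((1 - \<rho> ^ m) / 384\<^sup>2)) x"
    by (subst kernel_op_add[OF cond_u_measurable])
      (auto simp: kernel_op_cmult[OF cond_u_measurable] kernel_op_const[OF cond_u_measurable])
  also have "\<dots> \<le> kernel_op (cond_u A) ((kernel_op (cond_u A) ^^ m) ?G) x"
  proof (rule kernel_op_cond_u_mono)
    fix y :: real assume y: "y \<in> {0..1}"
    show "ennreal (\<rho> ^ m) * ?G y + ennreal ((1 - \<rho> ^ m) / 384\<^sup>2) \<le> (kernel_op (cond_u A) ^^ m) ?G y"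
      using Suc.IH[OF y] \<rho> \<rho>m unfolding \<rho>_def[symmetric] by (simp add: ennreal_mult')
  qed
  finally show ?case by (simp add: \<rho>_def)
qed simp

text \<open>Put a = 1/768. After A^2/384 steps the slope power is at most 1/e, hence 1/2, so the
  expectation of G is at least half the fixed point 1/384^2, that is 2 a^2. As G is at most a^2 off
  [a, 1 - a] and at most 1 on it, that interval has mass at least a^2.\<close>

lemma cond_u_interior_mass:
  assumes A: "20 \<le> A" and x: "x \<in> {0..1}"
  defines "m \<equiv> nat \<lceil>A\<^sup>2 / 384\<rceil>"
  shows "ennreal ((1 / 768)\<^sup>2) \<le> (kernel_op (cond_u A) ^^ m) (indicator {1 / 768..1 - 1 / 768}) x"
proof -
  have A2: "400 \<le> A\<^sup>2" using power_mono[OF A, of 2] by simp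
  define \<rho> where "\<rho> = 1 - 384 / A\<^sup>2"
  have "384 / A\<^sup>2 \<le> 1" using A A2 by (subst divide_le_eq_1_pos) auto
  then have \<rho>: "0 \<le> \<rho>" "\<rho> \<le> 1" by (auto simp: \<rho>_def)
  have "A\<^sup>2 / 384 \<le> m" unfolding m_def using A2 by linarith
  then have m: "1 \<le> 384 / A\<^sup>2 * m"
    using A2 by (subst times_divide_eq_left, subst pos_le_divide_eq) auto
  have "\<rho> ^ m \<le> exp (- (384 / A\<^sup>2)) ^ m"
    using \<rho> exp_ge_add_one_self[of "- (384 / A\<^sup>2)"] by (intro power_mono) (auto simp: \<rho>_def)
  also have "\<dots> = exp (- (384 / A\<^sup>2 * m))"
    by (simp add: exp_of_nat_mult[symmetric] mult.commute)
  also have "\<dots> \<le> exp (- 1)" using m by simp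
  also have "\<dots> \<le> 1 / 2"
    using exp_ge_add_one_self[of 1] by (simp add: exp_minus field_simps)
  finally have \<rho>m: "\<rho> ^ m \<le> 1 / 2" .
  let ?P = "kernel_op (cond_u A) ^^ m"
  have "ennreal (2 * (1 / 768)\<^sup>2) \<le> ennreal (\<rho> ^ m * (x * (1 - x))\<^sup>2 + (1 - \<rho> ^ m) / 384\<^sup>2)"
    using \<rho>m \<rho> by (intro ennreal_leI) (simp add: power2_eq_square add_increasing)
  also have "\<dots> \<le> ?P (\<lambda>y. ennreal ((y * (1 - y))\<^sup>2)) x"
    unfolding \<rho>_def by (rule funpow_cond_u_quartic[OF A x])
  also have "\<dots> \<le> ?P (\<lambda>y. ennreal ((1 / 768)\<^sup>2) + indicator {1 / 768..1 - 1 / 768} y) x"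
  proof (rule kernel_op_cond_u_funpow_mono[OF _ x])
    fix y :: real assume y: "y \<in> {0..1}"
    show "ennreal ((y * (1 - y))\<^sup>2) \<le> ennreal ((1 / 768)\<^sup>2) + indicator {1 / 768..1 - 1 / 768} y"
    proof (cases "y \<in> {1 / 768..1 - 1 / 768}")
      case True
      have "y * (1 - y) \<le> 1" using mult_mono[of y 1 "1 - y" 1] y by simp
      then have "(y * (1 - y))\<^sup>2 \<le> 1" using y by (intro power_le_one) auto
      then have "ennreal ((y * (1 - y))\<^sup>2) \<le> ennreal 1" by (rule ennreal_leI)
      then show ?thesis using True by (simp add: add_increasing)
    next
      case False
      then have "y \<le> 1 / 768 \<or> 1 - y \<le> 1 / 768" by auto
      then have "y * (1 - y) \<le> 1 / 768"
        using y mult_mono[of y "1 / 768" "1 - y" 1] mult_mono[of y 1 "1 - y" "1 / 768"] by auto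
      then have "(y * (1 - y))\<^sup>2 \<le> (1 / 768)\<^sup>2" using y by (intro power_mono) auto
      then show ?thesis using False by (simp add: ennreal_leI)
    qed
  qed
  also have "\<dots> = ennreal ((1 / 768)\<^sup>2) + ?P (indicator {1 / 768..1 - 1 / 768}) x"
    by (subst funpow_cond_u_add) (auto simp: funpow_cond_u_const)
  finally have "ennreal ((1 / 768)\<^sup>2) + ennreal ((1 / 768)\<^sup>2) \<le> ennreal ((1 / 768)\<^sup>2) + ?P (indicator {1 / 768..1 - 1 / 768}) x"
    by (simp flip: ennreal_plus)
  then show ?thesis by (subst (asm) ennreal_add_left_cancel_le) auto
qed

subsection \<open>Minorization of the Gibbs kernel\<close>

text \<open>Once a constant lower bound holds at every starting point, further steps preserve it,
  since averaging a constant returns it. Hence one bound for all large k, as the random number of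
  coordinate changes requires.\<close>

lemma cond_u_minorization:
  fixes A a :: real
  assumes A: "20 \<le> A" and f: "f \<in> borel_measurable borel"
    and k: "nat \<lceil>A\<^sup>2 / 384\<rceil> + nat \<lfloor>A\<^sup>2 / 4\<rfloor> < k"
  defines "a \<equiv> 1 / 768"
  shows "ennreal (a ^ 3 * exp (- 2)) * (\<integral>\<^sup>+y. f y * indicator {1 / 2 - a / 4..1 / 2 + a / 4} y \<partial>lborel)
    \<le> (kernel_op (cond_u A) ^^ k) f x"
proof -
  let ?P = "\<lambda>n. kernel_op (cond_u A) ^^ n"
  define m n where "m = nat \<lceil>A\<^sup>2 / 384\<rceil>" and "n = nat \<lfloor>A\<^sup>2 / 4\<rfloor>"
  have a: "0 < a" "a \<le> 1 / 2" by (auto simp: a_def)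
  define \<kappa> where "\<kappa> = ennreal (a * exp (- 2)) *
    (\<integral>\<^sup>+y. f y * indicator {1 / 2 - a / 4..1 / 2 + a / 4} y \<partial>lborel)"
  have 1: "\<kappa> * indicator {a..1 - a} y \<le> ?P n f y" for y
    using cond_u_interior_minorization[of A a y f] A a f
    by (auto simp: \<kappa>_def n_def split: split_indicator)
  have 2: "\<kappa> * ennreal (a\<^sup>2) \<le> ?P (m + n) f w" if w: "w \<in> {0..1}" for w
  proof -
    have "\<kappa> * ennreal (a\<^sup>2) \<le> \<kappa> * ?P m (indicator {a..1 - a}) w"
      using cond_u_interior_mass[OF A w] by (intro mult_left_mono) (auto simp: a_def m_def)
    also have "\<dots> = ?P m (\<lambda>y. \<kappa> * indicator {a..1 - a} y) w"
      by (subst funpow_cond_u_cmult) auto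
    also have "\<dots> \<le> ?P m (?P n f) w"
      by (rule kernel_op_cond_u_funpow_mono[OF 1 w])
    finally show ?thesis by (simp add: funpow_add)
  qed
  \<comment> \<open>The extra step removes the restriction on w: the state space is the whole line,
    and one update from any real number lands in the unit interval. This accounts for the strict
    inequality in the bound on k.\<close>
  have 3: "\<kappa> * ennreal (a\<^sup>2) \<le> ?P (Suc (m + n) + j) f w" for w j
  proof (induction j arbitrary: w)
    case 0
    have "\<kappa> * ennreal (a\<^sup>2) = kernel_op (cond_u A) (\<lambda>_. \<kappa> * ennreal (a\<^sup>2)) w"
      by (simp add: kernel_op_const[OF cond_u_measurable])
    also have "\<dots> \<le> kernel_op (cond_u A) (?P (m + n) f) w"
      by (rule kernel_op_cond_u_mono) (rule 2)
    finally show ?case by simp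
  next
    case (Suc j)
    have "\<kappa> * ennreal (a\<^sup>2) = kernel_op (cond_u A) (\<lambda>_. \<kappa> * ennreal (a\<^sup>2)) w"
      by (simp add: kernel_op_const[OF cond_u_measurable])
    also have "\<dots> \<le> kernel_op (cond_u A) (?P (Suc (m + n) + j) f) w"
      by (rule kernel_op_cond_u_mono) (rule Suc.IH)
    finally show ?case by simp
  qed
  obtain j where j: "k = Suc (m + n) + j"
    using k unfolding m_def[symmetric] n_def[symmetric] by (metis less_iff_Suc_add add_Suc)
  have "ennreal (a ^ 3 * exp (- 2)) = ennreal (a * exp (- 2)) * ennreal (a\<^sup>2)"
    using a by (simp add: power2_eq_square power3_eq_cube mult_ac flip: ennreal_mult')
  then show ?thesis
    using 3[of j x] unfolding j \<kappa>_def by (simp only: mult_ac)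
qed

text \<open>The minorizing measure of the Gibbs kernel: v is uniform on I and u is then drawn given
  v. This form matches a lower bound by the integral of \<open>op_u A f\<close> over I. The first
  coordinate 0 is a placeholder, overwritten by the update.\<close>

definition strip_dist :: "real \<Rightarrow> real set \<Rightarrow> (real \<times> real) measure" where
  "strip_dist A I = uniform_measure lborel I \<bind> (\<lambda>v. gibbs_update A (0, v) Coord_U)"

lemma strip_dist:
  assumes [measurable]: "I \<in> sets borel" and I: "emeasure lborel I \<noteq> 0" "emeasure lborel I \<noteq> \<infinity>"
  shows "prob_space (strip_dist A I)" and "sets (strip_dist A I) = sets borel"
    and "f \<in> borel_measurable borel \<Longrightarrow>
      (\<integral>\<^sup>+x. f x \<partial>strip_dist A I) = (\<integral>\<^sup>+v. op_u A f v * indicator I v \<partial>lborel) / emeasure lborel I"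
proof -
  have "(\<lambda>v. (0, v)) \<in> borel \<rightarrow>\<^sub>M (borel :: (real \<times> real) measure)"
    by (simp add: borel_prod[symmetric])
  from measurable_compose[OF this gibbs_update_measurable]
  have K: "(\<lambda>v. gibbs_update A (0, v) Coord_U) \<in> uniform_measure lborel I \<rightarrow>\<^sub>M prob_algebra borel"
    by (simp add: measurable_def uniform_measure_def del: gibbs_update.simps)
  have U: "uniform_measure lborel I \<in> space (prob_algebra (uniform_measure lborel I))"
    using I by (auto simp: space_prob_algebra intro: prob_space_uniform_measure)
  show "prob_space (strip_dist A I)" "sets (strip_dist A I) = sets borel"
    using prob_space_bind'[OF U K] sets_bind'[OF U K] by (simp_all add: strip_dist_def)
  assume f [measurable]: "f \<in> borel_measurable borel"
  have "(\<integral>\<^sup>+x. f x \<partial>strip_dist A I) =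
      (\<integral>\<^sup>+v. (\<integral>\<^sup>+x. f x \<partial>gibbs_update A (0, v) Coord_U) \<partial>uniform_measure lborel I)"
    unfolding strip_dist_def by (rule nn_integral_bind[OF f measurable_prob_algebraD[OF K]])
  also have "\<dots> = (\<integral>\<^sup>+v. op_u A f v \<partial>uniform_measure lborel I)"
    unfolding op_u_def kernel_op_def gibbs_update.simps
    by (subst nn_integral_distr) (use f in \<open>auto simp: borel_prod[symmetric]\<close>)
  also have "\<dots> = (\<integral>\<^sup>+v. op_u A f v * indicator I v \<partial>lborel) / emeasure lborel I"
    using I by (subst nn_integral_uniform_measure) auto
  finally show "(\<integral>\<^sup>+x. f x \<partial>strip_dist A I) = (\<integral>\<^sup>+v. op_u A f v * indicator I v \<partial>lborel) / emeasure lborel I" .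
qed

lemma gibbs_minorization:
  fixes A a :: real
  assumes A: "20 \<le> A" and f: "f \<in> borel_measurable borel"
  defines "a \<equiv> 1 / 768" and "n \<equiv> Suc (nat \<lceil>A\<^sup>2 / 384\<rceil> + nat \<lfloor>A\<^sup>2 / 4\<rfloor>)"
  shows "ennreal (a ^ 4 * exp (- 2) / 12) * (\<integral>\<^sup>+x. f x \<partial>strip_dist A {1 / 2 - a / 4..1 / 2 + a / 4})
    \<le> (kernel_op (gibbs_kernel A) ^^ (4 * n + 2)) f x"
proof -
  let ?I = "{1 / 2 - a / 4..1 / 2 + a / 4}"
  have a: "0 < a" by (simp add: a_def)
  have e: "emeasure lborel ?I = ennreal (a / 2)" using a by (simp add: field_simps)
  let ?X = "\<integral>\<^sup>+v. op_u A f v * indicator ?I v \<partial>lborel"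
  have "(\<integral>\<^sup>+x. f x \<partial>strip_dist A ?I) = ?X / ennreal (a / 2)"
    using a f by (subst strip_dist(3)) (auto simp: e)
  \<comment> \<open>The three factors come from the one-dimensional minorization, from
    \<open>gibbs_lower_bound\<close>, and from the length a/2 of the interval, by which the uniform
    distribution is normalized.\<close>
  moreover have "ennreal (a ^ 4 * exp (- 2) / 12) = ennreal (a ^ 3 * exp (- 2)) * ennreal (1 / 6) * ennreal (a / 2)"
    using a by (simp add: eval_nat_numeral mult_ac flip: ennreal_mult')
  moreover have "ennreal (a / 2) * (?X / ennreal (a / 2)) = ?X"
    using a by (subst ennreal_times_divide, subst mult.commute, subst mult_divide_eq_ennreal) auto
  ultimately have "ennreal (a ^ 4 * exp (- 2) / 12) * (\<integral>\<^sup>+x. f x \<partial>strip_dist A ?I) =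
      ennreal (a ^ 3 * exp (- 2)) * ennreal (1 / 6) * ?X"
    by (simp only: mult.assoc)
  also have "\<dots> = ennreal (a ^ 3 * exp (- 2)) * ?X * ennreal (1 / 6)"
    by (simp only: mult_ac)
  also have "\<dots> \<le> (kernel_op (gibbs_kernel A) ^^ (4 * n + 2)) f x"
  proof (rule gibbs_lower_bound[OF f])
    show "ennreal (a ^ 3 * exp (- 2)) * ?X \<le> (kernel_op (cond_u A) ^^ m) (op_u A f) y" if "n \<le> m" for m y
      unfolding a_def by (rule cond_u_minorization[OF A op_measurable(1)[OF f]]) (use that in \<open>simp add: n_def\<close>)
  qed (simp add: n_def)
  finally show ?thesis .
qed

theorem theorem1:
  fixes \<alpha> :: real
  assumes "0 < \<alpha>" and "\<alpha> < 1"
  shows "\<exists>\<beta>>0. \<forall>\<^sub>F A in at_top. ereal_of_enat (gibbs_mixing_time A \<alpha>) \<le> ereal (\<beta> * A\<^sup>2)"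
proof -
  define a c :: real where "a = 1 / 768" and "c = a ^ 4 * exp (- 2) / 12"
  have c: "0 < c" by (simp add: c_def a_def)
  \<comment> \<open>The constant c does not involve A, so neither does the number k of blocks; each
    block takes N = O(A^2) updates.\<close>
  obtain k where k: "(1 - c) ^ k < \<alpha>"
    using real_arch_pow_inv[of \<alpha> "1 - c"] assms c by auto
  \<comment> \<open>The factor 5 comes from N being at most 4 (A^2/384 + 1) + A^2 + 6; adding 1
    makes the coefficient visibly positive.\<close>
  have "ereal_of_enat (gibbs_mixing_time A \<alpha>) \<le> ereal ((5 * real k + 1) * A\<^sup>2)" if A: "20 \<le> A" for A
  proof -
    define n N where "n = Suc (nat \<lceil>A\<^sup>2 / 384\<rceil> + nat \<lfloor>A\<^sup>2 / 4\<rfloor>)" and "N = 4 * n + 2"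
    let ?I = "{1 / 2 - a / 4..1 / 2 + a / 4}"
    have A2: "400 \<le> A\<^sup>2" using power_mono[OF A, of 2] by simp
    have "real (nat \<lceil>A\<^sup>2 / 384\<rceil>) \<le> A\<^sup>2 / 384 + 1"
      using A2 of_int_ceiling_le_add_one[of "A\<^sup>2 / 384"] by simp
    moreover have "real (nat \<lfloor>A\<^sup>2 / 4\<rfloor>) \<le> A\<^sup>2 / 4"
      using A2 by (intro of_nat_floor) simp
    moreover have "real N = 4 * real (nat \<lceil>A\<^sup>2 / 384\<rceil>) + 4 * real (nat \<lfloor>A\<^sup>2 / 4\<rfloor>) + 6"
      unfolding N_def n_def by simp
    ultimately have N: "real N \<le> 5 * A\<^sup>2" using A2 by linarith
    have tv: "tv_dist (chain_law borel (gibbs_kernel A) x (k * N)) (diag_dist A) \<le> (1 - c) ^ k" for x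
    proof (rule doeblin_tv_bound[OF gibbs_kernel_measurable, where \<nu> = "strip_dist A ?I"])
      show "prob_space (strip_dist A ?I)" "sets (strip_dist A ?I) = sets borel"
        by (rule strip_dist; simp add: a_def)+
      show "ennreal c * (\<integral>\<^sup>+y. f y \<partial>strip_dist A ?I) \<le> (kernel_op (gibbs_kernel A) ^^ N) f y"
        if "f \<in> borel_measurable borel" for f y
        using gibbs_minorization[OF A that] unfolding c_def a_def N_def n_def .
    qed (use c in \<open>auto simp: prob_space_diag_dist diag_dist_stationary\<close>)
    have "gibbs_mixing_time A \<alpha> \<le> enat (k * N)"
      unfolding gibbs_mixing_time_def mixing_time_def
    proof (rule SUP_least)
      fix x :: "real \<times> real"
      have "tv_dist (chain_law borel (gibbs_kernel A) x (k * N)) (diag_dist A) \<le> \<alpha>"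
        using tv[of x] k by simp
      then show "(INF t\<in>{t. tv_dist (chain_law borel (gibbs_kernel A) x t) (diag_dist A) \<le> \<alpha>}. enat t)
          \<le> enat (k * N)"
        by (intro INF_lower) simp
    qed
    then have "ereal_of_enat (gibbs_mixing_time A \<alpha>) \<le> ereal_of_enat (enat (k * N))"
      by (simp only: ereal_of_enat_le_iff)
    also have "\<dots> = ereal (real k * real N)" by simp
    also have "\<dots> \<le> ereal ((5 * real k + 1) * A\<^sup>2)"
    proof -
      have "real k * real N \<le> real k * (5 * A\<^sup>2)" by (intro mult_left_mono N) simp
      also have "\<dots> \<le> (5 * real k + 1) * A\<^sup>2" by (simp add: algebra_simps)
      finally show ?thesis by simp
    qed
    finally show ?thesis .
  qed
  then have "\<forall>\<^sub>F A in at_top. ereal_of_enat (gibbs_mixing_time A \<alpha>) \<le> ereal ((5 * real k + 1) * A\<^sup>2)"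
    unfolding eventually_at_top_linorder by blast
  moreover have "0 < 5 * real k + 1" by simp
  ultimately show ?thesis by blast
qed

end
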